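(* Let $d\ge1$, $\mathsf{g}=\mathcal{N}(0,I_d)$, and let $\mu$ be a centred Borel probability measure on $\mathbb{R}^d$ which is absolutely continuous with respect to Lebesgue measure, has finite covariance matrix $\Sigma$, and has (finite) Poincaré constant $C_P=C_P(\mu)$. Then $$W_2(\mu*\mathsf{g},\mathsf{g})\le\sqrt{C_P\,\mathrm{tr}(\Sigma)}\qquad\text{and}\qquad W_1(\mu*\mathsf{g},\mathsf{g})\le\sqrt{C_P\,\mathrm{tr}(\Sigma)}.$$
   Context: The Poincaré constant $C_P(\mu)$ of a measure $\mu$ is the smallest $C\in[0,\infty]$ such that $\mathrm{Var}_\mu(f)\leq C\int\|\nabla f\|^2\,d\mu$ for all smooth $f\in L^2(\mu)$. "Centred" means $\int x\,\mu(dx)=0$. $*$ denotes convolution, and $W_p(\mu,\nu)=\left(\inf_{\tau\in\Pi(\mu,\nu)}\int\|z_1-z_2\|^p\,d\tau(z_1,z_2)\right)^{1/p}$ is the Wasserstein-$p$ distance for the Euclidean norm, with $\Pi(\mu,\nu)$ the set of couplings of $\mu$ and $\nu$. *)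

theory Defs
  imports "HOL-Probability.Probability"
begin

primrec Ck :: "nat \<Rightarrow> (real ^ 'n \<Rightarrow> real) \<Rightarrow> bool" where
  "Ck 0 f \<longleftrightarrow> continuous_on UNIV f"
| "Ck (Suc k) f \<longleftrightarrow>
     (\<forall>x. f differentiable (at x)) \<and> (\<forall>v. Ck k (\<lambda>x. frechet_derivative f (at x) v))"

definition smooth :: "(real ^ 'n \<Rightarrow> real) \<Rightarrow> bool" where
  "smooth f \<longleftrightarrow> (\<forall>k. Ck k f)"

definition gradient :: "(real ^ 'n \<Rightarrow> real) \<Rightarrow> real ^ 'n \<Rightarrow> real ^ 'n" where
  "gradient f x = (\<chi> i. frechet_derivative f (at x) (axis i 1))"

text \<open>
  Meant for probability measures. The Dirichlet energy is a nonnegative integral and may be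
  infinite. If some smooth square-integrable function has positive variance and zero energy,
  no constant is admissible, because \<open>\<infinity> * 0 = 0\<close> in \<open>ennreal\<close>, and the infimum of
  the empty set is \<open>\<infinity>\<close>, as it should be.
\<close>
definition poincare_constant :: "(real ^ 'n) measure \<Rightarrow> ennreal" where
  "poincare_constant \<mu> = Inf {C. \<forall>f. smooth f \<and> integrable \<mu> (\<lambda>x. (f x)\<^sup>2) \<longrightarrow>
     ennreal (\<integral>x. (f x - (\<integral>y. f y \<partial>\<mu>))\<^sup>2 \<partial>\<mu>)
       \<le> C * (\<integral>\<^sup>+x. ennreal ((norm (gradient f x))\<^sup>2) \<partial>\<mu>)}"

definition centred :: "(real ^ 'n) measure \<Rightarrow> bool" where
  "centred \<mu> \<longleftrightarrow> has_bochner_integral \<mu> (\<lambda>x. x) 0"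

definition mean :: "(real ^ 'n) measure \<Rightarrow> real ^ 'n" where
  "mean \<mu> = (\<integral>x. x \<partial>\<mu>)"

definition finite_covariance :: "(real ^ 'n) measure \<Rightarrow> bool" where
  "finite_covariance \<mu> \<longleftrightarrow> integrable \<mu> (\<lambda>x. x) \<and>
     (\<forall>i j. integrable \<mu> (\<lambda>x. (x $ i - mean \<mu> $ i) * (x $ j - mean \<mu> $ j)))"

definition covariance_matrix :: "(real ^ 'n) measure \<Rightarrow> real ^ 'n ^ 'n" where
  "covariance_matrix \<mu> = (\<chi> i j. \<integral>x. (x $ i - mean \<mu> $ i) * (x $ j - mean \<mu> $ j) \<partial>\<mu>)"

definition std_gaussian :: "(real ^ 'n) measure" where
  "std_gaussian = density lborel
     (\<lambda>x. ennreal (exp (- (norm x)\<^sup>2 / 2) / sqrt ((2 * pi) ^ CARD('n))))"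

definition couplings ::
  "(real ^ 'n) measure \<Rightarrow> (real ^ 'n) measure \<Rightarrow> ((real ^ 'n) \<times> (real ^ 'n)) measure set" where
  "couplings \<mu> \<nu> =
     {\<tau>. sets \<tau> = sets (\<mu> \<Otimes>\<^sub>M \<nu>) \<and> distr \<tau> \<mu> fst = \<mu> \<and> distr \<tau> \<nu> snd = \<nu>}"

definition transport_cost ::
  "real \<Rightarrow> (real ^ 'n) measure \<Rightarrow> (real ^ 'n) measure \<Rightarrow> ennreal" where
  "transport_cost p \<mu> \<nu> =
     (INF \<tau> \<in> couplings \<mu> \<nu>. \<integral>\<^sup>+z. ennreal (norm (fst z - snd z) powr p) \<partial>\<tau>)"

text \<open>Meant for \<open>p \<ge> 1\<close>. The case distinction takes the \<open>p\<close>-th root in \<open>[0,\<infinity>]\<close>.\<close>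
definition wasserstein ::
  "real \<Rightarrow> (real ^ 'n) measure \<Rightarrow> (real ^ 'n) measure \<Rightarrow> ennreal" where
  "wasserstein p \<mu> \<nu> = (if transport_cost p \<mu> \<nu> = \<infinity> then \<infinity>
     else ennreal (enn2real (transport_cost p \<mu> \<nu>) powr (1 / p)))"

end

theory Submission
  imports Defs
begin

text \<open>
  Let \<open>X\<close> have law \<open>\<mu>\<close>, let \<open>Z\<close> be an independent standard Gaussian, let \<open>Y\<^sub>l = l X + Z\<close> and let
  \<open>v\<^sub>l(y) = E[X | Y\<^sub>l = y]\<close>. For a bounded vector field \<open>g\<close>, the function \<open>G(x) = E g(l x + Z)\<close> is smooth
  and, by Gaussian integration by parts and Bessel's inequality, \<open>|\<nabla>G\<^sub>i|\<^sup>2 \<le> l\<^sup>2 E g\<^sub>i(l x + Z)\<^sup>2\<close>. As \<open>X\<close> is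
  centred, the Poincare inequality for the \<open>G\<^sub>i\<close> bounds \<open>E[X \<bullet> g(Y\<^sub>l)] = E[X \<bullet> G(X)]\<close> by
  \<open>l sqrt (C\<^sub>P tr \<Sigma>)\<close> times the norm of \<open>g(Y\<^sub>l)\<close>, and \<open>g = v\<^sub>l\<close> gives
  \<open>E |v\<^sub>l(Y\<^sub>l)|\<^sup>2 \<le> l\<^sup>2 C\<^sub>P tr \<Sigma>\<close>.

  A coupling of \<open>Y\<^sub>0\<close> and \<open>Y\<^sub>1\<close> is obtained from a Markov chain. With \<open>d = 1 / N\<close>, draw a fresh \<open>X'\<close> from
  the law of \<open>X\<close> given \<open>Y\<^sub>l\<close> and pass from \<open>Y\<^sub>l\<close> to \<open>Y\<^sub>l + d X'\<close>. Since \<open>(X', Y\<^sub>l)\<close> and \<open>(X, Y\<^sub>l)\<close> have the same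
  law, \<open>Y\<^sub>l + d X'\<close> has exactly the law of \<open>(l + d) X + Z\<close>. Given the past the increment has mean
  \<open>d v\<^sub>l(Y\<^sub>l)\<close>, so that after \<open>N\<close> steps the expected squared displacement is at most
  \<open>C\<^sub>P tr \<Sigma> + O(1 / N)\<close>.
\<close>

subsection \<open>The Gaussian density\<close>

definition gauss :: "'a::euclidean_space \<Rightarrow> real" where
  "gauss z = exp (- (norm z)\<^sup>2 / 2) / sqrt ((2 * pi) ^ DIM('a))"

lemma gauss_pos [simp]: "gauss z > 0"
  unfolding gauss_def by simp

lemma gauss_nonneg [simp]: "gauss z \<ge> 0"
  using gauss_pos [of z] by linarith

lemma continuous_gauss: "continuous_on UNIV gauss"
  unfolding gauss_def by (simp add: continuous_on_divide continuous_on_exp continuous_on_minus continuous_on_power continuous_on_norm_id)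

lemma measurable_gauss [measurable]: "gauss \<in> borel_measurable borel"
  using continuous_gauss by (rule borel_measurable_continuous_onI)

text \<open>The integrand factorises over an orthonormal basis into one-dimensional normal
  densities, each of mass 1. The case \<open>\<sigma> = 1\<close> normalises \<open>gauss\<close>;
  the case \<open>\<sigma> = sqrt 2\<close> makes \<open>decay 0\<close> integrable.\<close>

lemma nn_integral_exp_norm_square:
  assumes "\<sigma> > 0"
  shows "(\<integral>\<^sup>+z. ennreal (exp (- (norm z)\<^sup>2 / (2 * \<sigma>\<^sup>2))) \<partial>(lborel :: 'a::euclidean_space measure))
           = ennreal (sqrt ((2 * pi * \<sigma>\<^sup>2) ^ DIM('a)))"
proof -
  have prodeq: "exp (- (norm z)\<^sup>2 / (2 * \<sigma>\<^sup>2))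
      = sqrt ((2 * pi * \<sigma>\<^sup>2) ^ DIM('a)) * (\<Prod>b\<in>Basis. normal_density 0 \<sigma> (z \<bullet> b))" for z :: 'a
  proof -
    have n: "(norm z)\<^sup>2 = (\<Sum>b\<in>Basis. (z \<bullet> b)\<^sup>2)"
      unfolding power2_norm_eq_inner by (subst euclidean_inner) (simp add: power2_eq_square)
    have "(\<Prod>b\<in>Basis. normal_density 0 \<sigma> (z \<bullet> b))
       = (\<Prod>b\<in>(Basis::'a set). 1 / sqrt (2 * pi * \<sigma>\<^sup>2)) * (\<Prod>b\<in>Basis. exp (- (z \<bullet> b)\<^sup>2 / (2 * \<sigma>\<^sup>2)))"
      unfolding normal_density_def by (simp only: prod.distrib diff_zero)
    also have "(\<Prod>b\<in>Basis. exp (- (z \<bullet> b)\<^sup>2 / (2 * \<sigma>\<^sup>2))) = exp (- (norm z)\<^sup>2 / (2 * \<sigma>\<^sup>2))"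
      unfolding n by (simp add: exp_sum[symmetric] sum_negf sum_divide_distrib)
    finally show ?thesis
      using assms by (simp add: real_sqrt_power power_one_over)
  qed
  have "(\<integral>\<^sup>+z. ennreal (exp (- (norm z)\<^sup>2 / (2 * \<sigma>\<^sup>2))) \<partial>(lborel :: 'a measure))
      = (\<integral>\<^sup>+z. ennreal (sqrt ((2 * pi * \<sigma>\<^sup>2) ^ DIM('a)))
            * (\<Prod>b\<in>Basis. ennreal (normal_density 0 \<sigma> (z \<bullet> b))) \<partial>(lborel :: 'a measure))"
    unfolding prodeq by (simp add: ennreal_mult prod_ennreal prod_nonneg)
  also have "\<dots> = ennreal (sqrt ((2 * pi * \<sigma>\<^sup>2) ^ DIM('a)))
      * (\<integral>\<^sup>+z. (\<Prod>b\<in>Basis. ennreal (normal_density 0 \<sigma> (z \<bullet> b))) \<partial>(lborel :: 'a measure))"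
    by (intro nn_integral_cmult) auto
  also have "(\<integral>\<^sup>+z. (\<Prod>b\<in>Basis. ennreal (normal_density 0 \<sigma> (z \<bullet> b))) \<partial>(lborel :: 'a measure))
      = (\<Prod>b\<in>(Basis::'a set). (\<integral>\<^sup>+x. ennreal (normal_density 0 \<sigma> x) \<partial>lborel))"
    by (intro nn_integral_lborel_prod) auto
  also have "(\<integral>\<^sup>+x. ennreal (normal_density 0 \<sigma> x) \<partial>lborel) = 1"
    using assms by (subst nn_integral_eq_integral) (auto simp: integrable_normal_density integral_normal_density)
  finally show ?thesis by simp
qed

lemma nn_integral_gauss: "(\<integral>\<^sup>+z. ennreal (gauss z) \<partial>(lborel :: 'a::euclidean_space measure)) = 1"
proof -
  have "(\<integral>\<^sup>+z. ennreal (gauss z) \<partial>(lborel :: 'a measure))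
    = (\<integral>\<^sup>+z. ennreal (1 / sqrt ((2 * pi) ^ DIM('a)))
          * ennreal (exp (- (norm z)\<^sup>2 / (2 * 1\<^sup>2))) \<partial>(lborel :: 'a measure))"
    unfolding gauss_def by (simp add: ennreal_mult[symmetric])
  also have "\<dots> = ennreal (1 / sqrt ((2 * pi) ^ DIM('a))) * ennreal (sqrt ((2 * pi * 1\<^sup>2) ^ DIM('a)))"
    by (subst nn_integral_cmult) (simp_all only: nn_integral_exp_norm_square, auto)
  also have "\<dots> = 1"
    by (simp add: ennreal_mult[symmetric])
  finally show ?thesis .
qed

lemma integrable_gauss: "integrable lborel gauss"
  by (intro integrableI_nonneg) (auto simp: nn_integral_gauss)

lemma integral_gauss: "(\<integral>z. gauss z \<partial>(lborel :: 'a::euclidean_space measure)) = 1"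
  by (subst integral_eq_nn_integral) (auto simp: nn_integral_gauss)

text \<open>A scale of dominating functions. The quarter in the exponent, against the half in
  \<open>gauss\<close>, leaves room for every rate \<open>r\<close>, and lowering \<open>r\<close>
  by one pays for one factor \<open>norm z\<close>.\<close>

definition decay :: "real \<Rightarrow> 'a::euclidean_space \<Rightarrow> real" where
  "decay r z = exp (- r * norm z - (norm z)\<^sup>2 / 4)"

lemma decay_nonneg [simp]: "decay r z \<ge> 0"
  unfolding decay_def by simp

lemma norm_mult_decay_le: "norm z * decay (r + 1) z \<le> decay r z"
proof -
  have "decay (r + 1) z * exp (norm z) = decay r z"
    unfolding decay_def exp_add[symmetric] by (simp add: algebra_simps)
  moreover have "norm z \<le> exp (norm z)"
    using exp_ge_add_one_self[of "norm z"] by linarith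
  ultimately show ?thesis
    by (metis decay_nonneg mult.commute mult_left_mono)
qed

lemma decay_mono: "r \<le> s \<Longrightarrow> decay s z \<le> decay r z"
  unfolding decay_def by (simp add: mult_right_mono)

lemma measurable_decay [measurable]: "decay r \<in> borel_measurable borel"
  unfolding decay_def by measurable

lemma integrable_decay: "integrable lborel (decay 0 :: 'a::euclidean_space \<Rightarrow> real)"
proof (intro integrableI_nonneg)
  have "(\<integral>\<^sup>+z. ennreal (decay 0 z) \<partial>(lborel :: 'a measure)) = ennreal (sqrt ((2 * pi * (sqrt 2)\<^sup>2) ^ DIM('a)))"
    unfolding decay_def
    using nn_integral_exp_norm_square[where 'a='a, of "sqrt 2"] by simp
  then show "(\<integral>\<^sup>+z. ennreal (decay 0 z) \<partial>(lborel :: 'a measure)) < \<infinity>" by simp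
qed auto

text \<open>Taylor's formula of order two with Lagrange remainder; the intermediate point satisfies
  \<open>\<bar>t\<bar> \<le> \<bar>u\<bar>\<close>.\<close>

lemma abs_exp_remainder_le: "\<bar>exp u - 1 - u\<bar> \<le> u\<^sup>2 * exp \<bar>u\<bar>" for u :: real
proof -
  obtain t where t: "\<bar>t\<bar> \<le> \<bar>u\<bar>" "exp u = (\<Sum>m<2. u ^ m / fact m) + exp t / fact 2 * u\<^sup>2"
    using Maclaurin_exp_le[of u 2] by blast
  have "exp u - 1 - u = exp t / 2 * u\<^sup>2"
    using t(2) by (simp add: numeral_2_eq_2)
  moreover have "exp t \<le> exp \<bar>u\<bar>" using t(1) by simp
  ultimately show ?thesis
    by (simp only: abs_mult abs_divide abs_exp_cancel abs_power2 abs_numeral)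
       (smt (verit) exp_ge_zero mult.commute mult_left_mono zero_le_power2 field_sum_of_halves)
qed

subsection \<open>Functions with Gaussian decay\<close>

text \<open>The quadratic remainder, uniform up to the decay, allows differentiating a convolution under
  the integral sign without dominated convergence.\<close>
definition rapid :: "('a::euclidean_space \<Rightarrow> real) \<Rightarrow> ('a \<Rightarrow> 'a \<Rightarrow> real) \<Rightarrow> bool" where
  "rapid a a' \<longleftrightarrow> a \<in> borel_measurable borel \<and> (\<forall>h. (\<lambda>z. a' z h) \<in> borel_measurable borel)
     \<and> (\<forall>z. linear (a' z))
     \<and> (\<forall>r\<ge>0. \<exists>C\<ge>0. \<forall>z. \<bar>a z\<bar> \<le> C * decay r z \<and> (\<forall>h. \<bar>a' z h\<bar> \<le> C * norm h * decay r z)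
          \<and> (\<forall>h. norm h \<le> 1 \<longrightarrow> \<bar>a (z + h) - a z - a' z h\<bar> \<le> C * (norm h)\<^sup>2 * decay r z))"

text \<open>Completing the square bounds \<open>gauss\<close> by a multiple of
  \<open>decay r\<close> for every \<open>r\<close>. The remainder in \<open>h\<close> reduces, up
  to \<open>(norm h)\<^sup>2 / 2\<close>, to the second-order remainder of \<open>exp\<close> at
  \<open>u\<close>, the logarithm of \<open>gauss (z + h) / gauss z\<close>.\<close>

lemma rapid_gauss:
  "rapid (gauss :: 'a::euclidean_space \<Rightarrow> real) (\<lambda>z h. - (z \<bullet> h) * gauss z)"
proof -
  define K where "K = 1 / sqrt ((2 * pi) ^ DIM('a))"
  have K: "K > 0" unfolding K_def by simp
  have ge: "gauss z = K * exp (- (norm z)\<^sup>2 / 2)" for z :: 'a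
    unfolding gauss_def K_def by simp
  have gd: "gauss z \<le> K * exp (r\<^sup>2) * decay r z" for r and z :: 'a
  proof -
    have "0 \<le> (norm z / 2 - r)\<^sup>2" by simp
    then have "- (norm z)\<^sup>2 / 2 \<le> r\<^sup>2 + (- r * norm z - (norm z)\<^sup>2 / 4)"
      by (simp add: power2_eq_square field_simps)
    then have "exp (- (norm z)\<^sup>2 / 2) \<le> exp (r\<^sup>2) * decay r z"
      unfolding decay_def exp_add[symmetric] by simp
    then show ?thesis unfolding ge using K by (simp add: mult_left_mono mult.assoc)
  qed
  have rem: "\<bar>gauss (z + h) - gauss z - (- (z \<bullet> h) * gauss z)\<bar>
      \<le> (norm h)\<^sup>2 * (2 * exp 2 * exp (3 * norm z) * gauss z)" if h: "norm h \<le> 1" for z h :: 'a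
  proof -
    define u where "u = - (z \<bullet> h) - (norm h)\<^sup>2 / 2"
    have "gauss (z + h) = gauss z * exp u"
    proof -
      have "(norm (z + h))\<^sup>2 = (norm z)\<^sup>2 + 2 * (z \<bullet> h) + (norm h)\<^sup>2"
        by (simp add: power2_norm_eq_inner inner_add inner_commute algebra_simps)
      then show ?thesis unfolding ge u_def
        by (simp add: exp_add[symmetric] field_simps)
    qed
    then have eq: "gauss (z + h) - gauss z - (- (z \<bullet> h) * gauss z)
        = gauss z * ((exp u - 1 - u) - (norm h)\<^sup>2 / 2)"
      by (simp add: u_def algebra_simps)
    have zh: "\<bar>z \<bullet> h\<bar> \<le> norm z * norm h" by (rule Cauchy_Schwarz_ineq2)
    have hh: "(norm h)\<^sup>2 \<le> norm h" using h by (simp add: power2_eq_square mult_left_le_one_le)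
    have u: "\<bar>u\<bar> \<le> norm h * (norm z + 1)"
    proof -
      have "\<bar>u\<bar> \<le> \<bar>z \<bullet> h\<bar> + (norm h)\<^sup>2 / 2"
        unfolding u_def using zero_le_power2[of "norm h"] by linarith
      also have "\<dots> \<le> norm z * norm h + norm h"
        using zh hh norm_ge_zero[of h] by linarith
      finally show ?thesis by (simp add: algebra_simps)
    qed
    have z1: "norm z + 1 \<le> exp (norm z)" using exp_ge_add_one_self[of "norm z"] by linarith
    \<comment> \<open>Two factors \<open>exp (norm z)\<close> come from \<open>u\<^sup>2\<close> and
      a third will come from \<open>exp \<bar>u\<bar>\<close>; hence the 3 in
      \<open>exp (3 * norm z)\<close>.\<close>
    have u2: "u\<^sup>2 \<le> (norm h)\<^sup>2 * (exp (norm z))\<^sup>2"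
    proof -
      have "\<bar>u\<bar> \<le> norm h * exp (norm z)"
        using u z1 by (meson mult_left_mono norm_ge_zero order_trans)
      then have "\<bar>u\<bar>\<^sup>2 \<le> (norm h * exp (norm z))\<^sup>2" by (rule power_mono) simp
      then show ?thesis by (simp add: power_mult_distrib)
    qed
    have "\<bar>u\<bar> \<le> norm z + 1"
      using u h by (meson mult_left_le_one_le norm_ge_zero order_trans add_nonneg_nonneg zero_le_one)
    then have e: "exp \<bar>u\<bar> \<le> exp 1 * exp (norm z)"
      by (simp add: exp_add[symmetric] add.commute)
    have "\<bar>exp u - 1 - u\<bar> \<le> u\<^sup>2 * exp \<bar>u\<bar>" by (rule abs_exp_remainder_le)
    also have "\<dots> \<le> ((norm h)\<^sup>2 * (exp (norm z))\<^sup>2) * (exp 1 * exp (norm z))"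
      using u2 e by (intro mult_mono) auto
    also have "\<dots> = (norm h)\<^sup>2 * (exp 1 * exp (3 * norm z))"
      by (simp add: exp_add[symmetric] exp_double[symmetric] algebra_simps)
    also have "\<dots> \<le> (norm h)\<^sup>2 * (exp 2 * exp (3 * norm z))"
      by (intro mult_left_mono mult_right_mono) auto
    finally have b1: "\<bar>exp u - 1 - u\<bar> \<le> (norm h)\<^sup>2 * (exp 2 * exp (3 * norm z))" .
    have "1 \<le> exp 2 * exp (3 * norm z)" unfolding exp_add[symmetric] by simp
    then have b2: "(norm h)\<^sup>2 / 2 \<le> (norm h)\<^sup>2 * (exp 2 * exp (3 * norm z))"
      using mult_left_mono[of 1 "exp 2 * exp (3 * norm z)" "(norm h)\<^sup>2"] zero_le_power2[of "norm h"]
      by linarith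
    have "\<bar>(exp u - 1 - u) - (norm h)\<^sup>2 / 2\<bar> \<le> (norm h)\<^sup>2 * (2 * exp 2 * exp (3 * norm z))"
      using b1 b2 zero_le_power2[of "norm h"] unfolding mult.assoc mult.left_commute[of _ 2] by linarith
    then have "gauss z * \<bar>(exp u - 1 - u) - (norm h)\<^sup>2 / 2\<bar>
       \<le> gauss z * ((norm h)\<^sup>2 * (2 * exp 2 * exp (3 * norm z)))"
      by (intro mult_left_mono) auto
    then show ?thesis unfolding eq abs_mult by (simp add: algebra_simps)
  qed
  have b: "\<exists>C\<ge>0. \<forall>z::'a. \<bar>gauss z\<bar> \<le> C * decay r z \<and> (\<forall>h. \<bar>- (z \<bullet> h) * gauss z\<bar> \<le> C * norm h * decay r z)
          \<and> (\<forall>h. norm h \<le> 1 \<longrightarrow> \<bar>gauss (z + h) - gauss z - (- (z \<bullet> h) * gauss z)\<bar> \<le> C * (norm h)\<^sup>2 * decay r z)"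
    if r: "r \<ge> 0" for r
  proof -
    \<comment> \<open>The rate \<open>r + 3\<close> is chosen so that
      \<open>exp (3 * norm z)\<close> from \<open>rem\<close> is absorbed exactly, see
      \<open>e3\<close>; \<open>C\<close> collects the remaining constant of
      \<open>rem\<close>.\<close>
    define A where "A = K * exp ((r + 3)\<^sup>2)"
    define C where "C = 2 * exp 2 * A"
    have A: "A > 0" unfolding A_def using K by simp
    have AC: "A \<le> C"
    proof -
      have "1 \<le> 2 * exp (2::real)" using one_le_exp_iff[of "2::real"] by linarith
      then show ?thesis unfolding C_def using A by simp
    qed
    have g3: "gauss z \<le> A * decay (r + 3) z" for z :: 'a
      unfolding A_def by (rule gd)
    have e3: "exp (3 * norm z) * decay (r + 3) z = decay r z" for z :: 'a
      unfolding decay_def exp_add[symmetric] by (simp add: algebra_simps)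
    have 1: "\<bar>gauss z\<bar> \<le> C * decay r z" for z :: 'a
    proof -
      have "gauss z \<le> A * decay r z"
        using g3[of z] decay_mono[of r "r + 3" z] A by (smt (verit) mult_left_mono)
      also have "\<dots> \<le> C * decay r z" using AC by (simp add: mult_right_mono)
      finally show ?thesis by simp
    qed
    have 2: "\<bar>- (z \<bullet> h) * gauss z\<bar> \<le> C * norm h * decay r z" for z h :: 'a
    proof -
      have "\<bar>- (z \<bullet> h) * gauss z\<bar> \<le> (norm z * norm h) * (A * decay (r + 1) z)"
        unfolding abs_mult abs_minus_cancel using Cauchy_Schwarz_ineq2[of z h] g3[of z]
          decay_mono[of "r + 1" "r + 3" z] A
        by (intro mult_mono) (auto intro: order_trans[OF g3] mult_left_mono)
      also have "\<dots> = A * norm h * (norm z * decay (r + 1) z)" by simp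
      also have "\<dots> \<le> C * norm h * decay r z"
        using AC A norm_mult_decay_le[of z r] by (intro mult_mono) auto
      finally show ?thesis .
    qed
    have 3: "\<bar>gauss (z + h) - gauss z - (- (z \<bullet> h) * gauss z)\<bar> \<le> C * (norm h)\<^sup>2 * decay r z"
      if "norm h \<le> 1" for z h :: 'a
    proof -
      have "2 * exp 2 * exp (3 * norm z) * gauss z \<le> 2 * exp 2 * exp (3 * norm z) * (A * decay (r + 3) z)"
        using g3 by (intro mult_left_mono) auto
      also have "\<dots> = C * decay r z"
        unfolding C_def e3[of z, symmetric] by simp
      finally have "(norm h)\<^sup>2 * (2 * exp 2 * exp (3 * norm z) * gauss z) \<le> (norm h)\<^sup>2 * (C * decay r z)"
        by (intro mult_left_mono) auto
      then show ?thesis using rem[OF that, of z] by (simp add: algebra_simps)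
    qed
    show ?thesis using 1 2 3 A AC by (intro exI[of _ C]) auto
  qed
  have lin: "linear (\<lambda>h. - (z \<bullet> h) * gauss z)" for z :: 'a
    by (rule linearI) (simp_all add: inner_add_right algebra_simps)
  show ?thesis
    unfolding rapid_def using b lin by (auto simp del: abs_mult)
qed

lemma abs_inner_mult_decay_le: "\<bar>w \<bullet> z\<bar> * decay (r + 1) z \<le> norm w * decay r z"
proof -
  have "\<bar>w \<bullet> z\<bar> * decay (r + 1) z \<le> norm w * norm z * decay (r + 1) z"
    by (intro mult_right_mono Cauchy_Schwarz_ineq2) auto
  also have "\<dots> \<le> norm w * decay r z"
    unfolding mult.assoc by (intro mult_left_mono norm_mult_decay_le) auto
  finally show ?thesis .
qed

text \<open>Product rule. The remainder of the product is \<open>w \<bullet> z\<close> times the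
  remainder of \<open>a\<close>, plus \<open>w \<bullet> h\<close> times the increment of
  \<open>a\<close>; these cost \<open>W\<close> and \<open>2 * W\<close>, which gives the constant
  \<open>3 * W\<close>.\<close>

lemma rapid_mult_inner:
  fixes a :: "'a::euclidean_space \<Rightarrow> real"
  assumes "rapid a a'"
  shows "rapid (\<lambda>z. (w \<bullet> z) * a z) (\<lambda>z h. (w \<bullet> h) * a z + (w \<bullet> z) * a' z h)"
proof -
  have m: "a \<in> borel_measurable borel" "\<And>h. (\<lambda>z. a' z h) \<in> borel_measurable borel"
    and lin: "\<And>z. linear (a' z)"
    using assms unfolding rapid_def by auto
  have "\<exists>C\<ge>0. \<forall>z. \<bar>(w \<bullet> z) * a z\<bar> \<le> C * decay r z
      \<and> (\<forall>h. \<bar>(w \<bullet> h) * a z + (w \<bullet> z) * a' z h\<bar> \<le> C * norm h * decay r z)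
      \<and> (\<forall>h. norm h \<le> 1 \<longrightarrow> \<bar>(w \<bullet> (z + h)) * a (z + h) - (w \<bullet> z) * a z
            - ((w \<bullet> h) * a z + (w \<bullet> z) * a' z h)\<bar> \<le> C * (norm h)\<^sup>2 * decay r z)"
    if r: "r \<ge> 0" for r
  proof -
    \<comment> \<open>The bounds for \<open>a\<close> are taken at the rate \<open>r + 1\<close>,
      one more than required, to absorb the factor \<open>w \<bullet> z\<close>.\<close>
    obtain C where C: "C \<ge> 0" "\<And>z. \<bar>a z\<bar> \<le> C * decay (r + 1) z"
      "\<And>z h. \<bar>a' z h\<bar> \<le> C * norm h * decay (r + 1) z"
      "\<And>z h. norm h \<le> 1 \<Longrightarrow> \<bar>a (z + h) - a z - a' z h\<bar> \<le> C * (norm h)\<^sup>2 * decay (r + 1) z"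
      using assms r unfolding rapid_def
      by (metis add_nonneg_nonneg zero_le_one)
    have dm: "decay (r + 1) z \<le> decay r z" for z :: 'a by (rule decay_mono) simp
    have aux: "\<bar>(w \<bullet> z) * t\<bar> \<le> norm w * k * decay r z"
      if "\<bar>t\<bar> \<le> k * decay (r + 1) z" "k \<ge> 0" for z t k
    proof -
      have "\<bar>(w \<bullet> z) * t\<bar> \<le> \<bar>w \<bullet> z\<bar> * (k * decay (r + 1) z)"
        unfolding abs_mult using that by (intro mult_left_mono) auto
      also have "\<dots> = k * (\<bar>w \<bullet> z\<bar> * decay (r + 1) z)" by simp
      also have "\<dots> \<le> k * (norm w * decay r z)"
        using that abs_inner_mult_decay_le by (intro mult_left_mono) auto
      finally show ?thesis by (simp add: algebra_simps)
    qed
    have aux2: "\<bar>(w \<bullet> h) * t\<bar> \<le> norm w * norm h * k * decay r z"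
      if "\<bar>t\<bar> \<le> k * decay (r + 1) z" "k \<ge> 0" for z h :: 'a and t k
    proof -
      have "\<bar>(w \<bullet> h) * t\<bar> \<le> (norm w * norm h) * (k * decay r z)"
        unfolding abs_mult using that dm[of z]
        by (intro mult_mono Cauchy_Schwarz_ineq2) (auto intro: order_trans mult_left_mono)
      then show ?thesis by (simp add: algebra_simps)
    qed
    define W where "W = norm w * C"
    have W: "W \<ge> 0" unfolding W_def using C by simp
    have 1: "\<bar>(w \<bullet> z) * a z\<bar> \<le> 3 * W * decay r z" for z
    proof -
      have "\<bar>(w \<bullet> z) * a z\<bar> \<le> W * decay r z"
        using aux[OF C(2) C(1)] unfolding W_def by simp
      also have "\<dots> \<le> 3 * W * decay r z"
        using W by (intro mult_right_mono) auto
      finally show ?thesis .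
    qed
    have 2: "\<bar>(w \<bullet> h) * a z + (w \<bullet> z) * a' z h\<bar> \<le> 3 * W * norm h * decay r z" for z h
    proof -
      have "\<bar>(w \<bullet> h) * a z\<bar> \<le> W * norm h * decay r z"
        using aux2[OF C(2) C(1)] unfolding W_def by (simp add: mult.commute mult.left_commute)
      moreover have "\<bar>(w \<bullet> z) * a' z h\<bar> \<le> W * norm h * decay r z"
        using aux[OF C(3)] C(1) unfolding W_def by (simp add: mult.assoc)
      moreover have "0 \<le> W * norm h * decay r z" using W by simp
      ultimately show ?thesis by linarith
    qed
    have 3: "\<bar>(w \<bullet> (z + h)) * a (z + h) - (w \<bullet> z) * a z - ((w \<bullet> h) * a z + (w \<bullet> z) * a' z h)\<bar>
        \<le> 3 * W * (norm h)\<^sup>2 * decay r z" if h: "norm h \<le> 1" for z h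
    proof -
      have hh: "(norm h)\<^sup>2 \<le> norm h" using h by (simp add: power2_eq_square mult_left_le_one_le)
      have eq: "(w \<bullet> (z + h)) * a (z + h) - (w \<bullet> z) * a z - ((w \<bullet> h) * a z + (w \<bullet> z) * a' z h)
        = (w \<bullet> z) * (a (z + h) - a z - a' z h) + (w \<bullet> h) * (a (z + h) - a z)"
        by (simp add: inner_add_right algebra_simps)
      have "C * (norm h)\<^sup>2 * decay (r + 1) z \<le> C * norm h * decay (r + 1) z"
        using hh C(1) by (intro mult_mono) auto
      then have "\<bar>a (z + h) - a z\<bar> \<le> (2 * C * norm h) * decay (r + 1) z"
        using C(3)[of z h] C(4)[OF h, of z] by linarith
      from aux2[OF this, of h] C(1)
      have "\<bar>(w \<bullet> h) * (a (z + h) - a z)\<bar> \<le> 2 * (W * (norm h)\<^sup>2 * decay r z)"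
        unfolding W_def by (simp add: power2_eq_square mult.commute mult.left_commute)
      moreover have "\<bar>(w \<bullet> z) * (a (z + h) - a z - a' z h)\<bar> \<le> W * (norm h)\<^sup>2 * decay r z"
        using aux[OF C(4)[OF h]] C(1) unfolding W_def by (simp add: mult.assoc)
      ultimately show ?thesis unfolding eq by linarith
    qed
    show ?thesis using 1 2 3 W by (intro exI[of _ "3 * W"]) auto
  qed
  moreover have "linear (\<lambda>h. (w \<bullet> h) * a z + (w \<bullet> z) * a' z h)" for z
    by (rule linearI)
      (simp_all add: inner_add_right algebra_simps linear_add[OF lin] linear_scale[OF lin])
  ultimately show ?thesis
    unfolding rapid_def using m by (auto simp del: abs_mult)
qed

lemma rapid_add:
  assumes "rapid a a'" "rapid b b'"
  shows "rapid (\<lambda>z. a z + b z) (\<lambda>z h. a' z h + b' z h)"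
proof -
  have m: "a \<in> borel_measurable borel" "\<And>h. (\<lambda>z. a' z h) \<in> borel_measurable borel"
     "b \<in> borel_measurable borel" "\<And>h. (\<lambda>z. b' z h) \<in> borel_measurable borel"
    and lin: "\<And>z. linear (a' z)" "\<And>z. linear (b' z)"
    using assms unfolding rapid_def by auto
  have "\<exists>C\<ge>0. \<forall>z. \<bar>a z + b z\<bar> \<le> C * decay r z
      \<and> (\<forall>h. \<bar>a' z h + b' z h\<bar> \<le> C * norm h * decay r z)
      \<and> (\<forall>h. norm h \<le> 1 \<longrightarrow> \<bar>a (z + h) + b (z + h) - (a z + b z) - (a' z h + b' z h)\<bar>
            \<le> C * (norm h)\<^sup>2 * decay r z)"
    if r: "r \<ge> 0" for r
  proof -
    obtain C where C: "C \<ge> 0" "\<And>z. \<bar>a z\<bar> \<le> C * decay r z"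
      "\<And>z h. \<bar>a' z h\<bar> \<le> C * norm h * decay r z"
      "\<And>z h. norm h \<le> 1 \<Longrightarrow> \<bar>a (z + h) - a z - a' z h\<bar> \<le> C * (norm h)\<^sup>2 * decay r z"
      using assms r unfolding rapid_def by metis
    obtain D where D: "D \<ge> 0" "\<And>z. \<bar>b z\<bar> \<le> D * decay r z"
      "\<And>z h. \<bar>b' z h\<bar> \<le> D * norm h * decay r z"
      "\<And>z h. norm h \<le> 1 \<Longrightarrow> \<bar>b (z + h) - b z - b' z h\<bar> \<le> D * (norm h)\<^sup>2 * decay r z"
      using assms r unfolding rapid_def by metis
    have tri: "\<bar>s\<bar> \<le> C * k * d \<Longrightarrow> \<bar>t\<bar> \<le> D * k * d \<Longrightarrow> \<bar>s + t\<bar> \<le> (C + D) * k * d" for s t k d :: real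
      by (simp add: algebra_simps)
    have 1: "\<bar>a z + b z\<bar> \<le> (C + D) * decay r z" for z
      using tri[of "a z" 1 "decay r z" "b z"] C(2) D(2) by simp
    have 2: "\<bar>a' z h + b' z h\<bar> \<le> (C + D) * norm h * decay r z" for z h
      using tri C(3) D(3) by blast
    have 3: "\<bar>a (z + h) + b (z + h) - (a z + b z) - (a' z h + b' z h)\<bar> \<le> (C + D) * (norm h)\<^sup>2 * decay r z"
      if "norm h \<le> 1" for z h
    proof -
      have eq: "a (z + h) + b (z + h) - (a z + b z) - (a' z h + b' z h)
          = (a (z + h) - a z - a' z h) + (b (z + h) - b z - b' z h)" by simp
      show ?thesis unfolding eq using tri C(4) D(4) that by blast
    qed
    show ?thesis using 1 2 3 C(1) D(1) by (intro exI[of _ "C + D"]) auto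
  qed
  moreover have "linear (\<lambda>h. a' z h + b' z h)" for z
    using lin by (rule linear_compose_add)
  ultimately show ?thesis
    unfolding rapid_def using m by auto
qed

lemma rapid_scale:
  assumes "rapid a a'"
  shows "rapid (\<lambda>z. c * a z) (\<lambda>z h. c * a' z h)"
proof -
  have m: "a \<in> borel_measurable borel" "\<And>h. (\<lambda>z. a' z h) \<in> borel_measurable borel"
    and lin: "\<And>z. linear (a' z)"
    using assms unfolding rapid_def by auto
  have "\<exists>C\<ge>0. \<forall>z. \<bar>c * a z\<bar> \<le> C * decay r z
      \<and> (\<forall>h. \<bar>c * a' z h\<bar> \<le> C * norm h * decay r z)
      \<and> (\<forall>h. norm h \<le> 1 \<longrightarrow> \<bar>c * a (z + h) - c * a z - c * a' z h\<bar>
            \<le> C * (norm h)\<^sup>2 * decay r z)"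
    if r: "r \<ge> 0" for r
  proof -
    obtain C where C: "C \<ge> 0" "\<And>z. \<bar>a z\<bar> \<le> C * decay r z"
      "\<And>z h. \<bar>a' z h\<bar> \<le> C * norm h * decay r z"
      "\<And>z h. norm h \<le> 1 \<Longrightarrow> \<bar>a (z + h) - a z - a' z h\<bar> \<le> C * (norm h)\<^sup>2 * decay r z"
      using assms r unfolding rapid_def by metis
    have sc: "\<bar>c * t\<bar> \<le> \<bar>c\<bar> * C * k * d" if "\<bar>t\<bar> \<le> C * k * d" for t k d :: real
      unfolding abs_mult mult.assoc using that by (intro mult_left_mono) (auto simp: mult.assoc)
    have 1: "\<bar>c * a z\<bar> \<le> (\<bar>c\<bar> * C) * decay r z" for z
      using sc[of "a z" 1 "decay r z"] C(2) by simp
    have 2: "\<bar>c * a' z h\<bar> \<le> (\<bar>c\<bar> * C) * norm h * decay r z" for z h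
      using sc C(3) by blast
    have 3: "\<bar>c * a (z + h) - c * a z - c * a' z h\<bar> \<le> (\<bar>c\<bar> * C) * (norm h)\<^sup>2 * decay r z"
      if "norm h \<le> 1" for z h
      using sc[OF C(4)[OF that]] by (simp add: right_diff_distrib)
    show ?thesis using 1 2 3 C(1) by (intro exI[of _ "\<bar>c\<bar> * C"]) auto
  qed
  moreover have "linear (\<lambda>h. c * a' z h)" for z
    using linear_compose_scale_right[OF lin, of c z] by simp
  ultimately show ?thesis
    unfolding rapid_def using m by (auto simp del: abs_mult)
qed

text \<open>Polynomials times \<open>gauss\<close>, paired with their derivatives. The class is
  introduced because \<open>rapid\<close> gives no remainder bound for the derivative
  \<open>a'\<close>, so it cannot be iterated, whereas this class is closed under directional
  derivatives.\<close>

inductive gauss_poly :: "('a::euclidean_space \<Rightarrow> real) \<Rightarrow> ('a \<Rightarrow> 'a \<Rightarrow> real) \<Rightarrow> bool" where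
  base: "gauss_poly gauss (\<lambda>z h. - (z \<bullet> h) * gauss z)"
| mult: "gauss_poly a a' \<Longrightarrow>
    gauss_poly (\<lambda>z. (w \<bullet> z) * a z) (\<lambda>z h. (w \<bullet> h) * a z + (w \<bullet> z) * a' z h)"
| add: "gauss_poly a a' \<Longrightarrow> gauss_poly b b' \<Longrightarrow>
    gauss_poly (\<lambda>z. a z + b z) (\<lambda>z h. a' z h + b' z h)"
| scale: "gauss_poly a a' \<Longrightarrow> gauss_poly (\<lambda>z. c * a z) (\<lambda>z h. c * a' z h)"

lemma gauss_poly_rapid: "gauss_poly a a' \<Longrightarrow> rapid a a'"
  by (induction rule: gauss_poly.induct)
    (rule rapid_gauss rapid_mult_inner rapid_add rapid_scale; assumption)+

text \<open>Each constructor states a differentiation rule whose right-hand side is again built from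
  constructors, so induction applies.\<close>

lemma gauss_poly_directional:
  "gauss_poly a a' \<Longrightarrow> \<exists>b'. gauss_poly (\<lambda>z. a' z v) b'"
proof (induction rule: gauss_poly.induct)
  case base
  have "(\<lambda>z. - (z \<bullet> v) * gauss z) = (\<lambda>z. ((- v) \<bullet> z) * gauss z)"
    by (simp add: inner_commute)
  then show ?case using gauss_poly.mult[OF gauss_poly.base, of "- v"] by metis
next
  case (mult a a' w)
  then obtain b' where "gauss_poly (\<lambda>z. a' z v) b'" by blast
  from gauss_poly.add[OF gauss_poly.scale[OF mult.hyps] gauss_poly.mult[OF this]]
  show ?case by blast
next
  case (add a a' b b')
  then show ?case using gauss_poly.add by blast
next
  case (scale a a' c)
  then show ?case using gauss_poly.scale by blast
qed

section \<open>Translation invariance of Lebesgue integrals and domination by a shifted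
  \<open>decay 0\<close>\<close>

lemma nn_integral_lborel_shift:
  fixes c :: "'a::euclidean_space"
  assumes [measurable]: "f \<in> borel_measurable borel"
  shows "(\<integral>\<^sup>+y. f (c + y) \<partial>lborel) = (\<integral>\<^sup>+y. f y \<partial>lborel)"
  by (subst (2) lborel_distr_plus[of c, symmetric]) (subst nn_integral_distr, auto)

lemma integrable_lborel_shift:
  fixes c :: "'a::euclidean_space" and f :: "'a \<Rightarrow> 'b::{banach, second_countable_topology}"
  assumes "integrable lborel f"
  shows "integrable lborel (\<lambda>y. f (c + y))"
proof -
  have "integrable (distr lborel borel ((+) c)) f" using assms by (simp add: lborel_distr_plus)
  then show ?thesis by (rule integrable_distr[rotated]) simp
qed

lemma integral_lborel_shift:
  fixes c :: "'a::euclidean_space" and f :: "'a \<Rightarrow> 'b::{banach, second_countable_topology}"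
  assumes "f \<in> borel_measurable borel"
  shows "(\<integral>y. f (c + y) \<partial>lborel) = (\<integral>y. f y \<partial>lborel)"
  using integral_distr[of "(+) c" lborel borel f] assms by (simp add: lborel_distr_plus)

lemma integrable_bounded_mult:
  fixes g a :: "'a::euclidean_space \<Rightarrow> real"
  assumes "g \<in> borel_measurable borel" "a \<in> borel_measurable borel"
    and "\<And>y. \<bar>g y\<bar> \<le> M" "\<And>y. \<bar>a y\<bar> \<le> C * decay 0 (y - c)"
  shows "integrable lborel (\<lambda>y. g y * a y)"
proof (rule Bochner_Integration.integrable_bound)
  show "integrable lborel (\<lambda>y. M * (C * decay 0 (y - c)))"
    using integrable_lborel_shift[OF integrable_decay, of "- c"] by simp
  have "\<bar>g y * a y\<bar> \<le> M * (C * decay 0 (y - c))" for y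
    unfolding abs_mult using assms(3,4)[of y] by (intro mult_mono) auto
  then show "AE y in lborel. norm (g y * a y) \<le> norm (M * (C * decay 0 (y - c)))"
    by (intro always_eventually allI) (metis abs_ge_self order_trans real_norm_def)
qed (use assms in auto)

subsection \<open>Convolution with functions of Gaussian decay\<close>

text \<open>For \<open>a = gauss\<close> this is E g(l x + Z), the function G of the overview. The
  kernel \<open>a\<close> is kept general because differentiation in \<open>x\<close> falls on it,
  so that \<open>g\<close> need only be measurable and bounded.\<close>

definition smear :: "('a::euclidean_space \<Rightarrow> real) \<Rightarrow> real \<Rightarrow> ('a \<Rightarrow> real) \<Rightarrow> 'a \<Rightarrow> real" where
  "smear g l a x = (\<integral>y. g y * a (y - l *\<^sub>R x) \<partial>lborel)"

lemma rapidD: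
  assumes "rapid a a'"
  obtains C where "C \<ge> 0" "\<And>z. \<bar>a z\<bar> \<le> C * decay 0 z" "\<And>z h. \<bar>a' z h\<bar> \<le> C * norm h * decay 0 z"
      "\<And>z h. norm h \<le> 1 \<Longrightarrow> \<bar>a (z + h) - a z - a' z h\<bar> \<le> C * (norm h)\<^sup>2 * decay 0 z"
  using assms unfolding rapid_def by (metis order_refl)

lemma integrable_smear:
  assumes "rapid a a'" "g \<in> borel_measurable borel" "\<And>y. \<bar>g y\<bar> \<le> M"
  shows "integrable lborel (\<lambda>y. g y * a (y - c))"
proof -
  have [measurable]: "a \<in> borel_measurable borel" using assms(1) unfolding rapid_def by auto
  obtain C where "\<And>z. \<bar>a z\<bar> \<le> C * decay 0 z" using rapidD[OF assms(1)] by metis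
  then show ?thesis
    using assms(2,3) by (intro integrable_bounded_mult[where M = M and C = C and c = c]) auto
qed

lemma integrable_smear_deriv:
  assumes "rapid a a'" "g \<in> borel_measurable borel" "\<And>y. \<bar>g y\<bar> \<le> M"
  shows "integrable lborel (\<lambda>y. g y * a' (y - c) h)"
proof -
  have [measurable]: "(\<lambda>z. a' z h) \<in> borel_measurable borel" using assms(1) unfolding rapid_def by auto
  have m: "(\<lambda>y. a' (y - c) h) \<in> borel_measurable borel"
    using measurable_compose[of "\<lambda>y. y - c" borel borel "\<lambda>z. a' z h"] by simp
  obtain C where "\<And>z h. \<bar>a' z h\<bar> \<le> C * norm h * decay 0 z" using rapidD[OF assms(1)] by metis
  then show ?thesis
    using assms(2,3) m by (intro integrable_bounded_mult[where M = M and C = "C * norm h" and c = c]) auto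
qed

lemma has_derivative_quadratic_remainder:
  fixes f :: "'a::real_normed_vector \<Rightarrow> 'b::real_normed_vector"
  assumes "bounded_linear f'"
    and "\<And>h. norm h \<le> 1 \<Longrightarrow> norm (f (x + h) - f x - f' h) \<le> K * (norm h)\<^sup>2"
  shows "(f has_derivative f') (at x)"
  unfolding has_derivative_at_alt
proof (intro conjI allI impI)
  fix e :: real assume e: "e > 0"
  \<comment> \<open>The minimum with 1 keeps the increment in the unit ball, where the remainder
    bound is assumed; \<open>\<bar>K\<bar> + 1\<close> is positive whatever the sign of
    \<open>K\<close>.\<close>
  define d where "d = min 1 (e / (\<bar>K\<bar> + 1))"
  have d: "d > 0" unfolding d_def using e by simp
  have "norm (f y - f x - f' (y - x)) \<le> e * norm (y - x)" if y: "norm (y - x) < d" for y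
  proof -
    have "norm (f y - f x - f' (y - x)) \<le> K * (norm (y - x))\<^sup>2"
      using assms(2)[of "y - x"] y unfolding d_def by simp
    also have "\<dots> \<le> ((\<bar>K\<bar> + 1) * norm (y - x)) * norm (y - x)"
      unfolding power2_eq_square mult.assoc[symmetric] by (intro mult_right_mono) auto
    also have "\<dots> \<le> e * norm (y - x)"
    proof (intro mult_right_mono)
      have "norm (y - x) \<le> e / (\<bar>K\<bar> + 1)" using y unfolding d_def by simp
      then show "(\<bar>K\<bar> + 1) * norm (y - x) \<le> e" by (simp add: field_simps)
    qed auto
    finally show ?thesis .
  qed
  then show "\<exists>d>0. \<forall>y. norm (y - x) < d \<longrightarrow> norm (f y - f x - f' (y - x)) \<le> e * norm (y - x)"
    using d by blast
qed (rule assms)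

text \<open>The pointwise quadratic remainder of \<open>a\<close>, integrated against the bounded
  \<open>g\<close>, is a quadratic remainder for the integral. Moving \<open>x\<close> by
  \<open>h\<close> moves the argument of \<open>a\<close> by \<open>- (l *\<^sub>R h)\<close>, which
  stays in the unit ball since \<open>\<bar>l\<bar> \<le> 1\<close>.\<close>

lemma smear_has_derivative:
  fixes a :: "'a::euclidean_space \<Rightarrow> real"
  assumes a: "rapid a a'" and g: "g \<in> borel_measurable borel" "\<And>y. \<bar>g y\<bar> \<le> M"
    and l: "\<bar>l\<bar> \<le> 1"
  shows "(smear g l a has_derivative (\<lambda>h. - l * smear g l (\<lambda>z. a' z h) x)) (at x)"
proof -
  have lin: "linear (a' z)" for z using a unfolding rapid_def by auto
  obtain C where C: "C \<ge> 0"
      "\<And>z h. norm h \<le> 1 \<Longrightarrow> \<bar>a (z + h) - a z - a' z h\<bar> \<le> C * (norm h)\<^sup>2 * decay 0 z"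
    using rapidD[OF a] by metis
  note i1 = integrable_smear[OF a g] and i2 = integrable_smear_deriv[OF a g]
  define K where "K = (\<integral>y. M * (C * decay 0 (y - l *\<^sub>R x)) \<partial>lborel)"
  have M: "M \<ge> 0" using g(2)[of undefined] by linarith
  have iK: "integrable lborel (\<lambda>y. M * (C * decay 0 (y - l *\<^sub>R x)))"
    using integrable_lborel_shift[OF integrable_decay, of "- (l *\<^sub>R x)"] by simp
  show ?thesis
  proof (rule has_derivative_quadratic_remainder[where K = K])
    have "linear (\<lambda>h. - l * smear g l (\<lambda>z. a' z h) x)"
    proof (rule linearI)
      fix h k :: 'a and c :: real
      have "smear g l (\<lambda>z. a' z (h + k)) x = smear g l (\<lambda>z. a' z h) x + smear g l (\<lambda>z. a' z k) x"
        unfolding smear_def linear_add[OF lin] distrib_left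
        using i2 by (intro Bochner_Integration.integral_add) auto
      then show "- l * smear g l (\<lambda>z. a' z (h + k)) x
          = - l * smear g l (\<lambda>z. a' z h) x + - l * smear g l (\<lambda>z. a' z k) x"
        by (simp add: algebra_simps)
      have "smear g l (\<lambda>z. a' z (c *\<^sub>R h)) x = c * smear g l (\<lambda>z. a' z h) x"
        unfolding smear_def linear_scale[OF lin] real_scaleR_def mult.left_commute[of _ c]
        by simp
      then show "- l * smear g l (\<lambda>z. a' z (c *\<^sub>R h)) x = c *\<^sub>R (- l * smear g l (\<lambda>z. a' z h) x)"
        by simp
    qed
    then show "bounded_linear (\<lambda>h. - l * smear g l (\<lambda>z. a' z h) x)"
      by (rule linear_conv_bounded_linear[THEN iffD1])
  next
    fix h :: 'a assume h: "norm h \<le> 1"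
    have lh: "norm (- (l *\<^sub>R h)) \<le> norm h" using l by (simp add: mult_left_le_one_le)
    have a'l: "a' z (- (l *\<^sub>R h)) = - l * a' z h" for z
      using linear_scale[OF lin, of z "- l" h] by simp
    have eq: "smear g l a (x + h) - smear g l a x - - l * smear g l (\<lambda>z. a' z h) x
      = (\<integral>y. g y * a (y - l *\<^sub>R (x + h)) - g y * a (y - l *\<^sub>R x)
            - (- l) * (g y * a' (y - l *\<^sub>R x) h) \<partial>lborel)"
      unfolding smear_def using i1 i2 by simp
    have "norm (smear g l a (x + h) - smear g l a x - - l * smear g l (\<lambda>z. a' z h) x)
       \<le> (\<integral>y. (norm h)\<^sup>2 * (M * (C * decay 0 (y - l *\<^sub>R x))) \<partial>lborel)"
      unfolding eq
    proof (rule order_trans[OF integral_norm_bound integral_mono[OF integrable_norm]])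
      show "integrable lborel (\<lambda>y. g y * a (y - l *\<^sub>R (x + h)) - g y * a (y - l *\<^sub>R x)
            - - l * (g y * a' (y - l *\<^sub>R x) h))"
        using i1 i2 by (intro Bochner_Integration.integrable_diff integrable_mult_right) auto
      show "integrable lborel (\<lambda>y. (norm h)\<^sup>2 * (M * (C * decay 0 (y - l *\<^sub>R x))))"
        using iK by simp
      fix y :: 'a
      define z where "z = y - l *\<^sub>R x"
      have "g y * a (y - l *\<^sub>R (x + h)) - g y * a (y - l *\<^sub>R x) - - l * (g y * a' (y - l *\<^sub>R x) h)
          = g y * (a (z + - (l *\<^sub>R h)) - a z - a' z (- (l *\<^sub>R h)))"
        unfolding a'l z_def by (simp add: scaleR_add_right algebra_simps)
      then have "norm (g y * a (y - l *\<^sub>R (x + h)) - g y * a (y - l *\<^sub>R x) - - l * (g y * a' (y - l *\<^sub>R x) h))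
        = \<bar>g y\<bar> * \<bar>a (z + - (l *\<^sub>R h)) - a z - a' z (- (l *\<^sub>R h))\<bar>"
        by (simp add: abs_mult)
      also have "\<dots> \<le> M * (C * (norm h)\<^sup>2 * decay 0 z)"
      proof (intro mult_mono g(2))
        have "\<bar>a (z + - (l *\<^sub>R h)) - a z - a' z (- (l *\<^sub>R h))\<bar>
           \<le> C * (norm (- (l *\<^sub>R h)))\<^sup>2 * decay 0 z"
          using lh h by (intro C(2)) linarith
        also have "\<dots> \<le> C * (norm h)\<^sup>2 * decay 0 z"
          using lh C(1) by (intro mult_right_mono mult_left_mono power_mono) auto
        finally show "\<bar>a (z + - (l *\<^sub>R h)) - a z - a' z (- (l *\<^sub>R h))\<bar> \<le> C * (norm h)\<^sup>2 * decay 0 z" .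
      qed (use M in auto)
      finally show "norm (g y * a (y - l *\<^sub>R (x + h)) - g y * a (y - l *\<^sub>R x) - - l * (g y * a' (y - l *\<^sub>R x) h))
          \<le> (norm h)\<^sup>2 * (M * (C * decay 0 (y - l *\<^sub>R x)))"
        unfolding z_def by (simp add: algebra_simps)
    qed
    then show "norm (smear g l a (x + h) - smear g l a x - - l * smear g l (\<lambda>z. a' z h) x)
        \<le> K * (norm h)\<^sup>2"
      unfolding K_def by (simp add: mult.commute)
  qed
qed

lemma smear_scale: "smear g l (\<lambda>z. c * a z) x = c * smear g l a x"
  unfolding smear_def mult.left_commute[of _ c] by simp

text \<open>Induction on \<open>k\<close> with the kernel varying: a directional derivative of a
  smeared function is smeared again, with kernel \<open>- l * a' z v\<close>, still a polynomial
  times \<open>gauss\<close>.\<close>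

lemma Ck_smear:
  fixes a :: "real ^ 'n \<Rightarrow> real"
  assumes "gauss_poly a a'" and g: "g \<in> borel_measurable borel" "\<And>y. \<bar>g y\<bar> \<le> M"
    and l: "\<bar>l\<bar> \<le> 1"
  shows "Ck k (smear g l a)"
  using assms(1)
proof (induction k arbitrary: a a')
  case 0
  have "smear g l a differentiable at x" for x
    using smear_has_derivative[OF gauss_poly_rapid[OF 0] g l, of x] by (rule differentiableI)
  then have "continuous (at x) (smear g l a)" for x
    by (rule differentiable_imp_continuous_within)
  then show ?case by (simp add: continuous_at_imp_continuous_on)
next
  case (Suc k)
  note D = smear_has_derivative[OF gauss_poly_rapid[OF Suc.prems] g l]
  have "Ck k (\<lambda>x. frechet_derivative (smear g l a) (at x) v)" for v
  proof -
    have "frechet_derivative (smear g l a) (at x) v = smear g l (\<lambda>z. - l * a' z v) x" for x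
      using frechet_derivative_at[OF D[of x], symmetric]
      by (simp only: smear_scale)
    moreover obtain b' where "gauss_poly (\<lambda>z. a' z v) b'"
      using gauss_poly_directional[OF Suc.prems] by blast
    then have "Ck k (smear g l (\<lambda>z. - l * a' z v))"
      using Suc.IH[OF gauss_poly.scale] by blast
    ultimately show ?thesis by presburger
  qed
  moreover have "smear g l a differentiable at x" for x using D by (rule differentiableI)
  ultimately show ?case by simp
qed

text \<open>Smearing the constant 1 gives a function that is constant in \<open>x\<close> by
  translation invariance; its derivative is zero and is also the integral in question up to sign.
  This is the form in which Gaussian integration by parts is used.\<close>

lemma integral_rapid_deriv:
  fixes a :: "'a::euclidean_space \<Rightarrow> real"
  assumes "rapid a a'"
  shows "(\<integral>z. a' z h \<partial>lborel) = 0"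
proof -
  have m[measurable]: "a \<in> borel_measurable borel" using assms unfolding rapid_def by auto
  have "smear (\<lambda>_. 1) 1 a = (\<lambda>_. \<integral>z. a z \<partial>lborel)"
    unfolding smear_def using integral_lborel_shift[OF m, of "- _"] by (intro ext) simp
  then have "((\<lambda>_. (\<integral>z. a z \<partial>lborel)) has_derivative
      (\<lambda>h. - 1 * smear (\<lambda>_. 1) 1 (\<lambda>z. a' z h) 0)) (at 0)"
    using smear_has_derivative[OF assms, of "\<lambda>_. 1" 1 1 0] by simp
  from has_derivative_unique[OF this has_derivative_const]
  have "- 1 * smear (\<lambda>_. 1) 1 (\<lambda>z. a' z h) 0 = 0" by meson
  then show ?thesis unfolding smear_def by simp
qed

text \<open>The derivative of \<open>(w \<bullet> z) * gauss z\<close> along \<open>w\<close> is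
  \<open>(norm w)\<^sup>2 * gauss z - (w \<bullet> z)\<^sup>2 * gauss z\<close>, and its integral
  vanishes.\<close>

lemma gauss_second_moment:
  fixes w :: "'a::euclidean_space"
  shows "integrable lborel (\<lambda>z. (w \<bullet> z)\<^sup>2 * gauss z)"
    and "(\<integral>z. (w \<bullet> z)\<^sup>2 * gauss z \<partial>lborel) = (norm w)\<^sup>2"
proof -
  note r = gauss_poly.base[THEN gauss_poly.mult, of w]
  have "integrable lborel (\<lambda>z. 1 * ((w \<bullet> (z - 0)) * ((w \<bullet> (z - 0)) * gauss (z - 0))))"
    using r[THEN gauss_poly.mult, of w, THEN gauss_poly_rapid] by (rule integrable_smear[where M = 1]) auto
  then show i: "integrable lborel (\<lambda>z. (w \<bullet> z)\<^sup>2 * gauss z)"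
    by (simp add: power2_eq_square mult.assoc)
  have "(\<integral>z. (w \<bullet> w) * gauss z + (w \<bullet> z) * (- (z \<bullet> w) * gauss z) \<partial>lborel) = 0"
    using integral_rapid_deriv[OF gauss_poly_rapid[OF r], of w] .
  also have "(\<lambda>z. (w \<bullet> w) * gauss z + (w \<bullet> z) * (- (z \<bullet> w) * gauss z))
      = (\<lambda>z. (norm w)\<^sup>2 * gauss z - (w \<bullet> z)\<^sup>2 * gauss z)"
    unfolding power2_norm_eq_inner by (simp add: power2_eq_square inner_commute algebra_simps)
  also have "(\<integral>z. (norm w)\<^sup>2 * gauss z - (w \<bullet> z)\<^sup>2 * gauss z \<partial>lborel)
      = (norm w)\<^sup>2 - (\<integral>z. (w \<bullet> z)\<^sup>2 * gauss z \<partial>lborel)"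
    using i integrable_gauss by (subst Bochner_Integration.integral_diff) (auto simp: integral_gauss)
  finally show "(\<integral>z. (w \<bullet> z)\<^sup>2 * gauss z \<partial>lborel) = (norm w)\<^sup>2" by simp
qed

section \<open>Smoothness, size and gradient of functions smeared by the Gaussian\<close>

lemma power2_le_of_abs_le: "\<bar>t\<bar> \<le> M \<Longrightarrow> t\<^sup>2 \<le> M\<^sup>2" for t M :: real
  using power_mono[of "\<bar>t\<bar>" M 2] by simp

lemma gradient_inner:
  assumes "f differentiable (at x)"
  shows "gradient f x \<bullet> h = frechet_derivative f (at x) h"
proof -
  let ?D = "frechet_derivative f (at x)"
  have lin: "linear ?D"
    using assms by (rule linear_frechet_derivative)
  have "?D h = ?D (\<Sum>i\<in>UNIV. h $ i *\<^sub>R axis i 1)"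
    by (simp add: basis_expansion flip: scalar_mult_eq_scaleR)
  also have "\<dots> = (\<Sum>i\<in>UNIV. h $ i * ?D (axis i 1))"
    using lin by (simp add: linear_sum linear_scale)
  finally show ?thesis
    unfolding gradient_def by (simp add: inner_vec_def mult.commute)
qed

lemma smear_gauss_differentiable:
  assumes "g \<in> borel_measurable borel" "\<And>y. \<bar>g y\<bar> \<le> M" "\<bar>l\<bar> \<le> 1"
  shows "smear g l gauss differentiable (at x)"
  using smear_has_derivative[OF rapid_gauss assms] by (rule differentiableI)

lemma continuous_smear_gauss:
  assumes "g \<in> borel_measurable borel" "\<And>y. \<bar>g y\<bar> \<le> M" "\<bar>l\<bar> \<le> 1"
  shows "continuous_on UNIV (smear g l gauss)"
  using smear_gauss_differentiable[OF assms]
  by (meson continuous_at_imp_continuous_on differentiable_imp_continuous_within)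

lemma smooth_smear_gauss:
  assumes "g \<in> borel_measurable borel" "\<And>y. \<bar>g y\<bar> \<le> M" "\<bar>l\<bar> \<le> 1"
  shows "smooth (smear g l gauss)"
  unfolding smooth_def using Ck_smear[OF gauss_poly.base assms] by blast

lemma integral_gauss_shift: "(\<integral>y. gauss (y - c) \<partial>(lborel :: 'a::euclidean_space measure)) = 1"
  using integral_lborel_shift[of gauss "- c"] by (simp add: integral_gauss)

lemma integrable_gauss_shift: "integrable lborel (\<lambda>y. gauss (y - c))"
  using integrable_lborel_shift[OF integrable_gauss, of "- c"] by simp

lemma abs_smear_gauss_le:
  assumes "g \<in> borel_measurable borel" "\<And>y. \<bar>g y\<bar> \<le> M"
  shows "\<bar>smear g l gauss x\<bar> \<le> M"
proof -
  have "norm (smear g l gauss x) \<le> (\<integral>y. M * gauss (y - l *\<^sub>R x) \<partial>lborel)"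
    unfolding smear_def
  proof (rule order_trans[OF integral_norm_bound integral_mono[OF integrable_norm]])
    show "integrable lborel (\<lambda>y. g y * gauss (y - l *\<^sub>R x))"
      by (rule integrable_smear[OF rapid_gauss assms])
    show "integrable lborel (\<lambda>y. M * gauss (y - l *\<^sub>R x))"
      by (intro integrable_mult_right integrable_gauss_shift)
    show "norm (g y * gauss (y - l *\<^sub>R x)) \<le> M * gauss (y - l *\<^sub>R x)" for y
      using assms(2)[of y] by (simp add: abs_mult mult_right_mono)
  qed
  then show ?thesis by (simp add: integral_gauss_shift)
qed

text \<open>The components of \<open>gradient (smear g l gauss) x / l\<close> are the coefficients of \<open>g\<close> along
  the coordinate functions, which are orthonormal for the Gaussian centred at \<open>l *\<^sub>R x\<close>; this is
  Bessel's inequality.\<close>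
lemma norm_gradient_smear_gauss_le:
  fixes g :: "real ^ 'n \<Rightarrow> real"
  assumes g: "g \<in> borel_measurable borel" "\<And>y. \<bar>g y\<bar> \<le> M" and l: "\<bar>l\<bar> \<le> 1"
  shows "(norm (gradient (smear g l gauss) x))\<^sup>2 \<le> l\<^sup>2 * smear (\<lambda>y. (g y)\<^sup>2) l gauss x"
proof -
  define G where "G = gradient (smear g l gauss) x"
  have g2: "(\<lambda>y. (g y)\<^sup>2) \<in> borel_measurable borel" "\<And>y. \<bar>(g y)\<^sup>2\<bar> \<le> M\<^sup>2"
    using g(1) power2_le_of_abs_le[OF g(2)] by simp_all
  have [measurable]: "g \<in> borel_measurable borel" by (rule g)
  \<comment> \<open>The derivative is taken along the gradient itself, so that it equals
    \<open>(norm G)\<^sup>2\<close>.\<close>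
  have D: "frechet_derivative (smear g l gauss) (at x) G
      = - l * smear g l (\<lambda>z. - (z \<bullet> G) * gauss z) x"
    by (rule fun_cong[OF frechet_derivative_at[OF smear_has_derivative[OF rapid_gauss g l], symmetric]])
  have i1: "integrable lborel (\<lambda>y. g y * (- ((y - l *\<^sub>R x) \<bullet> G) * gauss (y - l *\<^sub>R x)))"
    by (rule integrable_smear_deriv[OF rapid_gauss g])
  have i2: "integrable lborel (\<lambda>y. (g y)\<^sup>2 * gauss (y - l *\<^sub>R x))"
    by (rule integrable_smear[OF rapid_gauss g2])
  have i3: "integrable lborel (\<lambda>y. (G \<bullet> (y - l *\<^sub>R x))\<^sup>2 * gauss (y - l *\<^sub>R x))"
    using integrable_lborel_shift[OF gauss_second_moment(1)[of G], of "- (l *\<^sub>R x)"] by simp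
  have e3: "(\<integral>y. (G \<bullet> (y - l *\<^sub>R x))\<^sup>2 * gauss (y - l *\<^sub>R x) \<partial>lborel) = (norm G)\<^sup>2"
    using integral_lborel_shift[of "\<lambda>z. (G \<bullet> z)\<^sup>2 * gauss z" "- (l *\<^sub>R x)"]
    by (simp add: gauss_second_moment(2))
  have "(norm G)\<^sup>2 = - l * smear g l (\<lambda>z. - (z \<bullet> G) * gauss z) x"
    using gradient_inner[OF smear_gauss_differentiable[OF g l], of x G, folded G_def] D
    by (simp add: power2_norm_eq_inner)
  also have "\<dots> = (\<integral>y. - l * (g y * (- ((y - l *\<^sub>R x) \<bullet> G) * gauss (y - l *\<^sub>R x))) \<partial>lborel)"
    unfolding smear_def by simp
  also have "\<dots> \<le> (\<integral>y. (l\<^sup>2 / 2) * ((g y)\<^sup>2 * gauss (y - l *\<^sub>R x))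
        + (1 / 2) * ((G \<bullet> (y - l *\<^sub>R x))\<^sup>2 * gauss (y - l *\<^sub>R x)) \<partial>lborel)"
  proof (rule integral_mono)
    show "integrable lborel (\<lambda>y. - l * (g y * (- ((y - l *\<^sub>R x) \<bullet> G) * gauss (y - l *\<^sub>R x))))"
      by (rule integrable_mult_right[OF i1])
    show "integrable lborel (\<lambda>y. (l\<^sup>2 / 2) * ((g y)\<^sup>2 * gauss (y - l *\<^sub>R x))
        + (1 / 2) * ((G \<bullet> (y - l *\<^sub>R x))\<^sup>2 * gauss (y - l *\<^sub>R x)))"
      by (intro Bochner_Integration.integrable_add integrable_mult_right i2 i3)
    fix y
    define u where "u = G \<bullet> (y - l *\<^sub>R x)"
    \<comment> \<open>Bessel's inequality by completing the square: the term in
      \<open>u\<^sup>2\<close> integrates to half of \<open>(norm G)\<^sup>2\<close> and is absorbed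
      by the left-hand side.\<close>
    have "0 \<le> (l * g y - u)\<^sup>2" by simp
    then have "(l * g y) * u \<le> l\<^sup>2 / 2 * (g y)\<^sup>2 + 1 / 2 * u\<^sup>2"
      by (simp add: power2_eq_square field_simps)
    then have "(l * g y) * u * gauss (y - l *\<^sub>R x)
        \<le> (l\<^sup>2 / 2 * (g y)\<^sup>2 + 1 / 2 * u\<^sup>2) * gauss (y - l *\<^sub>R x)"
      by (rule mult_right_mono) simp
    then show "- l * (g y * (- ((y - l *\<^sub>R x) \<bullet> G) * gauss (y - l *\<^sub>R x)))
        \<le> (l\<^sup>2 / 2) * ((g y)\<^sup>2 * gauss (y - l *\<^sub>R x))
        + (1 / 2) * ((G \<bullet> (y - l *\<^sub>R x))\<^sup>2 * gauss (y - l *\<^sub>R x))"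
      unfolding inner_commute[of "y - l *\<^sub>R x" G] u_def[symmetric] by (simp add: algebra_simps)
  qed
  also have "\<dots> = l\<^sup>2 / 2 * smear (\<lambda>y. (g y)\<^sup>2) l gauss x + 1 / 2 * (norm G)\<^sup>2"
    using i2 i3 unfolding smear_def e3[symmetric] by (subst Bochner_Integration.integral_add) auto
  finally show ?thesis unfolding G_def by simp
qed

text \<open>Any \<open>c\<close> strictly above the infimum dominates some admissible constant.
  Working with such \<open>c\<close> avoids showing that the infimum is attained.\<close>

lemma poincare_inequality:
  assumes "poincare_constant \<mu> < ennreal c" "smooth f" "integrable \<mu> (\<lambda>x. (f x)\<^sup>2)"
  shows "ennreal (\<integral>x. (f x - (\<integral>y. f y \<partial>\<mu>))\<^sup>2 \<partial>\<mu>)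
      \<le> ennreal c * (\<integral>\<^sup>+x. ennreal ((norm (gradient f x))\<^sup>2) \<partial>\<mu>)"
proof -
  obtain C where "C < ennreal c"
    "ennreal (\<integral>x. (f x - (\<integral>y. f y \<partial>\<mu>))\<^sup>2 \<partial>\<mu>)
       \<le> C * (\<integral>\<^sup>+x. ennreal ((norm (gradient f x))\<^sup>2) \<partial>\<mu>)"
    using assms unfolding poincare_constant_def Inf_less_iff by blast
  then show ?thesis
    by (meson less_imp_le mult_right_mono order_trans zero_le)
qed

lemma borel_measurable_vec_nth [measurable (raw)]:
  fixes f :: "'a \<Rightarrow> real ^ 'n"
  assumes "f \<in> borel_measurable M"
  shows "(\<lambda>x. f x $ i) \<in> borel_measurable M"
proof -
  have "(\<lambda>x :: real ^ 'n. x $ i) \<in> borel_measurable borel"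
    by (intro borel_measurable_continuous_onI continuous_intros)
  from measurable_compose[OF assms this] show ?thesis .
qed

lemma power2_vec_nth_le: "(x $ i)\<^sup>2 \<le> (norm x)\<^sup>2" for x :: "real ^ 'n"
  by (metis component_le_norm_cart abs_norm_cancel abs_le_square_iff)

lemma power2_norm_vec: "(norm x)\<^sup>2 = (\<Sum>i\<in>UNIV. (x $ i)\<^sup>2)" for x :: "real ^ 'n"
  unfolding power2_norm_eq_inner by (simp add: inner_vec_def power2_eq_square)

subsection \<open>The conditional expectation of the signal\<close>

locale square_integrable_measure = prob_space \<mu> for \<mu> :: "(real ^ 'n) measure" +
  assumes sets_eq [measurable_cong]: "sets \<mu> = sets borel"
    and square_integrable: "integrable \<mu> (\<lambda>x. (norm x)\<^sup>2)"
begin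

section \<open>Integrability of bounded functions, coordinates and their products under a second
  moment\<close>

lemma integrable_bounded:
  fixes f :: "real ^ 'n \<Rightarrow> real"
  assumes "f \<in> borel_measurable borel" "\<And>x. \<bar>f x\<bar> \<le> M"
  shows "integrable \<mu> f"
  using assms by (intro integrable_const_bound[where B = M]) (auto simp: measurable_cong_sets[OF sets_eq refl])

lemma integrable_nth_square: "integrable \<mu> (\<lambda>x. (x $ i)\<^sup>2)"
  using square_integrable
  by (rule Bochner_Integration.integrable_bound) (auto simp: power2_vec_nth_le)

lemma integrable_norm_bounded_mult:
  fixes f :: "real ^ 'n \<Rightarrow> real"
  assumes f: "f \<in> borel_measurable borel" "\<And>x. \<bar>f x\<bar> \<le> M"
  shows "integrable \<mu> (\<lambda>x. norm x * f x)"
proof (rule Bochner_Integration.integrable_bound)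
  show "integrable \<mu> (\<lambda>x. M * (1 + (norm x)\<^sup>2))"
    by (intro integrable_mult_right Bochner_Integration.integrable_add square_integrable) simp
  have "norm (norm x * f x) \<le> norm (M * (1 + (norm x)\<^sup>2))" for x :: "real ^ 'n"
  proof -
    have "2 * norm x \<le> 1 + (norm x)\<^sup>2"
      using zero_le_power2[of "norm x - 1"] by (simp add: power2_eq_square algebra_simps)
    then have "norm x * \<bar>f x\<bar> \<le> (1 + (norm x)\<^sup>2) * M"
      using f(2)[of x] by (intro mult_mono) (auto intro: order_trans[of _ "2 * norm x"])
    then show ?thesis using f(2)[of x] by (simp add: abs_mult mult.commute)
  qed
  then show "AE x in \<mu>. norm (norm x * f x) \<le> norm (M * (1 + (norm x)\<^sup>2))" by simp
qed (use f in \<open>simp add: measurable_cong_sets[OF sets_eq refl]\<close>)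

lemma integrable_nth_bounded_mult:
  fixes f :: "real ^ 'n \<Rightarrow> real"
  assumes f: "f \<in> borel_measurable borel" "\<And>x. \<bar>f x\<bar> \<le> M"
  shows "integrable \<mu> (\<lambda>x. x $ i * f x)"
  by (rule Bochner_Integration.integrable_bound[OF integrable_norm_bounded_mult[OF assms]])
    (use f in \<open>auto simp: measurable_cong_sets[OF sets_eq refl] abs_mult
       intro!: mult_right_mono component_le_norm_cart\<close>)

lemma integrable_nth: "integrable \<mu> (\<lambda>x. x $ i)"
  using integrable_nth_bounded_mult[of "\<lambda>_. 1" 1] by simp

text \<open>The covariance of a centred coordinate with G is split by Young's inequality, and the
  variance of G is controlled by the Poincare inequality together with the gradient bound. The
  weight \<open>t\<close> stays free, since its best value is known only once \<open>g\<close> is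
  chosen.\<close>

lemma component_smear_bound:
  fixes g :: "real ^ 'n \<Rightarrow> real"
  assumes P: "poincare_constant \<mu> < ennreal c" "c \<ge> 0"
    and cent: "(\<integral>x. x $ i \<partial>\<mu>) = 0"
    and g: "g \<in> borel_measurable borel" "\<And>y. \<bar>g y\<bar> \<le> M" and l: "\<bar>l\<bar> \<le> 1" and t: "t > 0"
  shows "2 * (\<integral>x. x $ i * smear g l gauss x \<partial>\<mu>)
     \<le> t * (\<integral>x. (x $ i)\<^sup>2 \<partial>\<mu>) + c * l\<^sup>2 / t * (\<integral>x. smear (\<lambda>y. (g y)\<^sup>2) l gauss x \<partial>\<mu>)"
proof -
  let ?G = "smear g l gauss"
  define m where "m = (\<integral>x. ?G x \<partial>\<mu>)"
  have g2: "(\<lambda>y. (g y)\<^sup>2) \<in> borel_measurable borel" "\<And>y. \<bar>(g y)\<^sup>2\<bar> \<le> M\<^sup>2"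
    using g(1) power2_le_of_abs_le[OF g(2)] by simp_all
  have Gm[measurable]: "?G \<in> borel_measurable borel"
    using continuous_smear_gauss[OF g l] by (rule borel_measurable_continuous_onI)
  have Em[measurable]: "smear (\<lambda>y. (g y)\<^sup>2) l gauss \<in> borel_measurable borel"
    using continuous_smear_gauss[OF g2 l] by (rule borel_measurable_continuous_onI)
  have Gb: "\<bar>?G x\<bar> \<le> M" for x by (rule abs_smear_gauss_le[OF g])
  have Eb: "\<bar>smear (\<lambda>y. (g y)\<^sup>2) l gauss x\<bar> \<le> M\<^sup>2" for x by (rule abs_smear_gauss_le[OF g2])
  have E0: "smear (\<lambda>y. (g y)\<^sup>2) l gauss x \<ge> 0" for x
    unfolding smear_def by (intro Bochner_Integration.integral_nonneg) auto
  have G2: "integrable \<mu> (\<lambda>x. (?G x)\<^sup>2)"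
    using power2_le_of_abs_le[OF Gb] by (intro integrable_bounded[of _ "M\<^sup>2"]) simp_all
  have iG: "integrable \<mu> ?G" by (rule integrable_bounded[OF Gm Gb])
  have iE: "integrable \<mu> (smear (\<lambda>y. (g y)\<^sup>2) l gauss)" by (rule integrable_bounded[OF Em Eb])
  have iv: "integrable \<mu> (\<lambda>x. (?G x - m)\<^sup>2)"
    using G2 iG unfolding power2_diff by simp
  have "ennreal (\<integral>x. (?G x - m)\<^sup>2 \<partial>\<mu>) \<le> ennreal c * (\<integral>\<^sup>+x. ennreal ((norm (gradient ?G x))\<^sup>2) \<partial>\<mu>)"
    unfolding m_def by (rule poincare_inequality[OF P(1) smooth_smear_gauss[OF g l] G2])
  also have "\<dots> \<le> ennreal c * (\<integral>\<^sup>+x. ennreal (l\<^sup>2 * smear (\<lambda>y. (g y)\<^sup>2) l gauss x) \<partial>\<mu>)"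
    by (intro mult_left_mono nn_integral_mono ennreal_leI norm_gradient_smear_gauss_le[OF g l]) auto
  also have "(\<integral>\<^sup>+x. ennreal (l\<^sup>2 * smear (\<lambda>y. (g y)\<^sup>2) l gauss x) \<partial>\<mu>)
      = ennreal (\<integral>x. l\<^sup>2 * smear (\<lambda>y. (g y)\<^sup>2) l gauss x \<partial>\<mu>)"
    using E0 iE by (intro nn_integral_eq_integral) auto
  also have "ennreal c * \<dots> = ennreal (c * l\<^sup>2 * (\<integral>x. smear (\<lambda>y. (g y)\<^sup>2) l gauss x \<partial>\<mu>))"
    using P(2) E0 by (simp add: ennreal_mult[symmetric] mult.assoc)
  finally have var: "(\<integral>x. (?G x - m)\<^sup>2 \<partial>\<mu>) \<le> c * l\<^sup>2 * (\<integral>x. smear (\<lambda>y. (g y)\<^sup>2) l gauss x \<partial>\<mu>)"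
    using P(2) E0 by (subst (asm) ennreal_le_iff) auto
  have ixG: "integrable \<mu> (\<lambda>x. x $ i * ?G x)" by (rule integrable_nth_bounded_mult[OF Gm Gb])
  \<comment> \<open>Subtracting the mean \<open>m\<close> from G changes nothing because the
    coordinate has mean zero; it makes the variance appear.\<close>
  have "2 * (\<integral>x. x $ i * ?G x \<partial>\<mu>) = (\<integral>x. 2 * (x $ i * ?G x) - 2 * m * x $ i \<partial>\<mu>)"
    using ixG integrable_nth cent by simp
  also have "\<dots> \<le> (\<integral>x. t * (x $ i)\<^sup>2 + 1 / t * (?G x - m)\<^sup>2 \<partial>\<mu>)"
  proof (rule integral_mono)
    fix x
    have "0 \<le> (t * x $ i - (?G x - m))\<^sup>2 / t" using t by simp
    also have "\<dots> = t * (x $ i)\<^sup>2 + 1 / t * (?G x - m)\<^sup>2 - 2 * x $ i * (?G x - m)"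
      using t by (simp add: power2_eq_square field_simps)
    finally show "2 * (x $ i * ?G x) - 2 * m * x $ i \<le> t * (x $ i)\<^sup>2 + 1 / t * (?G x - m)\<^sup>2"
      by (simp add: algebra_simps)
  qed (use ixG integrable_nth iv integrable_nth_square in auto)
  also have "\<dots> = t * (\<integral>x. (x $ i)\<^sup>2 \<partial>\<mu>) + 1 / t * (\<integral>x. (?G x - m)\<^sup>2 \<partial>\<mu>)"
    using iv integrable_nth_square by simp
  also have "\<dots> \<le> t * (\<integral>x. (x $ i)\<^sup>2 \<partial>\<mu>)
      + 1 / t * (c * l\<^sup>2 * (\<integral>x. smear (\<lambda>y. (g y)\<^sup>2) l gauss x \<partial>\<mu>))"
    using var t by (intro add_left_mono mult_left_mono) auto
  finally show ?thesis by (simp add: mult.commute)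
qed

text \<open>The Lebesgue density of the law of l X + Z.\<close>

definition mix :: "real \<Rightarrow> real ^ 'n \<Rightarrow> real" where
  "mix l y = (\<integral>x. gauss (y - l *\<^sub>R x) \<partial>\<mu>)"

text \<open>Bayes' formula for v_l(y) = E[X | l X + Z = y], which is the mean increment of the chain
  per unit of \<open>l\<close>. The denominator is never zero, by \<open>mix_pos\<close>.\<close>

definition velocity :: "real \<Rightarrow> real ^ 'n \<Rightarrow> real ^ 'n" where
  "velocity l y = (\<chi> i. (\<integral>x. x $ i * gauss (y - l *\<^sub>R x) \<partial>\<mu>) / mix l y)"

section \<open>Positivity, integrability and measurability for the mixture density and the
  conditional mean\<close>

lemma gauss_le: "gauss (z :: real ^ 'n) \<le> gauss (0 :: real ^ 'n)"
  unfolding gauss_def by (intro divide_right_mono) auto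

lemma abs_gauss_le: "\<bar>gauss (z :: real ^ 'n)\<bar> \<le> gauss (0 :: real ^ 'n)"
  using gauss_le[of z] by simp

lemma integrable_gauss_mix: "integrable \<mu> (\<lambda>x. gauss (y - l *\<^sub>R x))"
  by (rule integrable_bounded[OF _ abs_gauss_le]) simp

lemma integrable_nth_gauss: "integrable \<mu> (\<lambda>x. x $ i * gauss (y - l *\<^sub>R x))"
  by (rule integrable_nth_bounded_mult[OF _ abs_gauss_le]) simp

lemma integrable_square_gauss: "integrable \<mu> (\<lambda>x. (norm x)\<^sup>2 * gauss (y - l *\<^sub>R x))"
proof (rule Bochner_Integration.integrable_bound)
  show "integrable \<mu> (\<lambda>x. (norm x)\<^sup>2 * gauss (0 :: real ^ 'n))"
    by (rule integrable_mult_left) (simp add: square_integrable)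
  show "AE x in \<mu>. norm ((norm x)\<^sup>2 * gauss (y - l *\<^sub>R x)) \<le> norm ((norm x)\<^sup>2 * gauss (0 :: real ^ 'n))"
    by (intro AE_I2) (simp add: abs_mult mult_left_mono gauss_le)
qed simp

lemma mix_pos: "mix l y > 0"
proof -
  have "mix l y \<noteq> 0"
  proof
    assume "mix l y = 0"
    then have "AE x in \<mu>. gauss (y - l *\<^sub>R x) = 0"
      unfolding mix_def using integral_nonneg_eq_0_iff_AE[OF integrable_gauss_mix] by simp
    then have "AE x in \<mu>. False" by (auto simp: less_imp_neq[OF gauss_pos, symmetric])
    then show False by simp
  qed
  moreover have "mix l y \<ge> 0" unfolding mix_def by simp
  ultimately show ?thesis by simp
qed

lemma measurable_gauss_diff [measurable]:
  "(\<lambda>(y, x). gauss (y - l *\<^sub>R x :: real ^ 'n)) \<in> borel_measurable (borel \<Otimes>\<^sub>M \<mu>)"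
  by measurable

lemma measurable_mix [measurable]: "mix l \<in> borel_measurable borel"
  unfolding mix_def by measurable

lemma measurable_velocity [measurable]: "velocity l \<in> borel_measurable borel"
proof (rule borel_measurable_euclidean_space[THEN iffD2], rule ballI)
  fix b :: "real ^ 'n" assume "b \<in> Basis"
  then obtain i where b: "b = axis i 1" unfolding Basis_vec_def by auto
  show "(\<lambda>y. velocity l y \<bullet> b) \<in> borel_measurable borel"
    unfolding b velocity_def by (simp add: inner_axis) measurable
qed

text \<open>Fubini: E g(Y_l) is computed once by conditioning on X and once from the density of
  Y_l.\<close>

lemma integral_smear_gauss:
  assumes [measurable]: "g \<in> borel_measurable borel" and g: "\<And>y. \<bar>g y\<bar> \<le> M"
  shows "integrable lborel (\<lambda>y. g y * mix l y)"
    and "(\<integral>x. smear g l gauss x \<partial>\<mu>) = (\<integral>y. g y * mix l y \<partial>lborel)"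
proof -
  interpret pair_sigma_finite \<mu> "lborel :: (real ^ 'n) measure" ..
  have M: "M \<ge> 0" using g[of undefined] by linarith
  have "integrable (\<mu> \<Otimes>\<^sub>M lborel) (\<lambda>(x, y). g y * gauss (y - l *\<^sub>R x))"
  proof (rule Fubini_integrable)
    have "integrable lborel (\<lambda>y. g y * gauss (y - l *\<^sub>R x))" for x
      by (rule integrable_smear[OF rapid_gauss assms])
    then show "AE x in \<mu>. integrable lborel (\<lambda>y. case (x, y) of (x, y) \<Rightarrow> g y * gauss (y - l *\<^sub>R x))"
      by simp
    have "\<bar>smear (\<lambda>y. \<bar>g y\<bar>) l gauss x\<bar> \<le> M" for x
      using g by (intro abs_smear_gauss_le) auto
    then show "integrable \<mu> (\<lambda>x. \<integral>y. norm (case (x, y) of (x, y) \<Rightarrow> g y * gauss (y - l *\<^sub>R x)) \<partial>lborel)"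
      by (intro integrable_const_bound[where B = M]) (auto simp: smear_def abs_mult)
  qed measurable
  note i = this
  show "integrable lborel (\<lambda>y. g y * mix l y)"
    using integrable_snd[OF i] unfolding mix_def by simp
  show "(\<integral>x. smear g l gauss x \<partial>\<mu>) = (\<integral>y. g y * mix l y \<partial>lborel)"
    using Fubini_integral[OF i] unfolding mix_def smear_def by simp
qed

text \<open>The characteristic identity of conditional expectation, E[X_i g(Y_l)] =
  E[v_l(Y_l)_i g(Y_l)], again by Fubini. Absolute integrability holds because smearing
  \<open>\<bar>g\<bar>\<close> gives a bounded function and the coordinate is integrable.\<close>

lemma integral_nth_smear_gauss:
  assumes [measurable]: "g \<in> borel_measurable borel" and g: "\<And>y. \<bar>g y\<bar> \<le> M"
  shows "integrable lborel (\<lambda>y. g y * (velocity l y $ i * mix l y))"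
    and "(\<integral>x. x $ i * smear g l gauss x \<partial>\<mu>) = (\<integral>y. g y * (velocity l y $ i * mix l y) \<partial>lborel)"
proof -
  interpret pair_sigma_finite \<mu> "lborel :: (real ^ 'n) measure" ..
  have M: "M \<ge> 0" using g[of undefined] by linarith
  have v: "velocity l y $ i * mix l y = (\<integral>x. x $ i * gauss (y - l *\<^sub>R x) \<partial>\<mu>)" for y
    unfolding velocity_def using mix_pos[of l y] by simp
  have "integrable (\<mu> \<Otimes>\<^sub>M lborel) (\<lambda>(x, y). g y * (x $ i * gauss (y - l *\<^sub>R x)))"
  proof (rule Fubini_integrable)
    have "integrable lborel (\<lambda>y. x $ i * (g y * gauss (y - l *\<^sub>R x)))" for x
      by (intro integrable_mult_right integrable_smear[OF rapid_gauss assms])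
    then show "AE x in \<mu>. integrable lborel (\<lambda>y. case (x, y) of (x, y) \<Rightarrow> g y * (x $ i * gauss (y - l *\<^sub>R x)))"
      by (simp add: mult.left_commute)
    have b: "\<bar>smear (\<lambda>y. \<bar>g y\<bar>) l gauss x\<bar> \<le> M" for x
      using g by (intro abs_smear_gauss_le) auto
    have eq: "(\<integral>y. norm (case (x, y) of (x, y) \<Rightarrow> g y * (x $ i * gauss (y - l *\<^sub>R x))) \<partial>lborel)
        = \<bar>x $ i\<bar> * smear (\<lambda>y. \<bar>g y\<bar>) l gauss x" for x
      unfolding smear_def by (simp add: abs_mult mult.left_commute[of _ "\<bar>x $ i\<bar>"])
    have m: "smear (\<lambda>y. \<bar>g y\<bar>) l gauss \<in> borel_measurable borel"
      unfolding smear_def by measurable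
    show "integrable \<mu> (\<lambda>x. \<integral>y. norm (case (x, y) of (x, y) \<Rightarrow> g y * (x $ i * gauss (y - l *\<^sub>R x))) \<partial>lborel)"
      unfolding eq using integrable_abs[OF integrable_nth_bounded_mult[OF m b, of i]]
      by (rule Bochner_Integration.integrable_bound) (use m in \<open>auto simp: abs_mult measurable_cong_sets[OF sets_eq refl]\<close>)
  qed measurable
  note i = this
  show "integrable lborel (\<lambda>y. g y * (velocity l y $ i * mix l y))"
    using integrable_snd[OF i] unfolding v by simp
  have e: "(\<integral>y. g y * (x $ i * gauss (y - l *\<^sub>R x)) \<partial>lborel) = x $ i * smear g l gauss x" for x
    unfolding smear_def by (simp add: mult.left_commute[of "g _" "_ $ i"])
  show "(\<integral>x. x $ i * smear g l gauss x \<partial>\<mu>) = (\<integral>y. g y * (velocity l y $ i * mix l y) \<partial>lborel)"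
    using Fubini_integral[OF i] unfolding v by (simp add: e)
qed

text \<open>The test functions are the components of the conditional mean itself, cut off to be
  bounded. The same quantity \<open>w\<close> then occurs on both sides, and being a finite real it
  can be cancelled.\<close>

lemma truncated_velocity_bound:
  assumes P: "poincare_constant \<mu> < ennreal c" "c \<ge> 0"
    and cent: "\<And>i. (\<integral>x. x $ i \<partial>\<mu>) = 0" and l: "\<bar>l\<bar> \<le> 1"
  shows "(\<integral>\<^sup>+y. ennreal (of_bool (norm (velocity l y) \<le> M) * (norm (velocity l y))\<^sup>2 * mix l y) \<partial>lborel)
    \<le> ennreal (c * l\<^sup>2 * (\<integral>x. (norm x)\<^sup>2 \<partial>\<mu>))"
proof -
  define g where "g i y = of_bool (norm (velocity l y) \<le> M) * velocity l y $ i" for i y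
  have gm[measurable]: "g i \<in> borel_measurable borel" for i unfolding g_def by measurable
  have gb: "\<bar>g i y\<bar> \<le> \<bar>M\<bar>" for i y
    unfolding g_def using component_le_norm_cart[of "velocity l y" i] by auto
  have g2: "(\<lambda>y. (g i y)\<^sup>2) \<in> borel_measurable borel" "\<And>y. \<bar>(g i y)\<^sup>2\<bar> \<le> \<bar>M\<bar>\<^sup>2" for i
    using power2_le_of_abs_le[OF gb] by auto
  define w where "w = (\<Sum>i\<in>UNIV. \<integral>y. (g i y)\<^sup>2 * mix l y \<partial>lborel)"
  define s where "s = (\<integral>x. (norm x)\<^sup>2 \<partial>\<mu>)"
  have s: "s = (\<Sum>i\<in>UNIV. \<integral>x. (x $ i)\<^sup>2 \<partial>\<mu>)"
    unfolding s_def power2_norm_vec using integrable_nth_square by simp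
  have ww: "(\<integral>y. g i y * (velocity l y $ i * mix l y) \<partial>lborel) = (\<integral>y. (g i y)\<^sup>2 * mix l y \<partial>lborel)" for i
    by (intro Bochner_Integration.integral_cong) (auto simp: g_def power2_eq_square)
  have main: "2 * w \<le> t * s + c * l\<^sup>2 / t * w" if t: "t > 0" for t
  proof -
    have "2 * (\<integral>y. (g i y)\<^sup>2 * mix l y \<partial>lborel)
      \<le> t * (\<integral>x. (x $ i)\<^sup>2 \<partial>\<mu>) + c * l\<^sup>2 / t * (\<integral>y. (g i y)\<^sup>2 * mix l y \<partial>lborel)" for i
      using component_smear_bound[OF P cent gm gb l t, of i i]
      unfolding integral_smear_gauss(2)[OF g2] integral_nth_smear_gauss(2)[OF gm gb] ww .
    then have "(\<Sum>i\<in>UNIV. 2 * (\<integral>y. (g i y)\<^sup>2 * mix l y \<partial>lborel))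
      \<le> (\<Sum>i\<in>UNIV. t * (\<integral>x. (x $ i)\<^sup>2 \<partial>\<mu>) + c * l\<^sup>2 / t * (\<integral>y. (g i y)\<^sup>2 * mix l y \<partial>lborel))"
      by (intro sum_mono)
    then show ?thesis unfolding s w_def sum.distrib sum_distrib_left .
  qed
  have "w \<le> c * l\<^sup>2 * s"
  \<comment> \<open>The best weight \<open>t = c * l\<^sup>2\<close> is not admissible when it
    vanishes, as it does at the start of the chain where \<open>l = 0\<close>; there
    \<open>t\<close> is made arbitrarily small instead.\<close>
  proof (cases "c * l\<^sup>2 = 0")
    case True
    have "w \<le> 0 + e" if e: "e > 0" for e
    proof -
      have s0: "s \<ge> 0" unfolding s_def by simp
      have "2 * w \<le> e / (s + 1) * s" using main[of "e / (s + 1)"] e s0 True by simp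
      also have "\<dots> \<le> e" using e s0 by (simp add: field_simps)
      finally show ?thesis using e by linarith
    qed
    then have "w \<le> 0" by (rule field_le_epsilon)
    then show ?thesis unfolding True by simp
  next
    case False
    then have "c * l\<^sup>2 > 0" using P(2) by (metis less_eq_real_def mult_nonneg_nonneg zero_le_power2)
    \<comment> \<open>With \<open>t = c * l\<^sup>2\<close> the last term of \<open>main\<close> is
      exactly \<open>w\<close>.\<close>
    from main[OF this] show ?thesis using False by simp
  qed
  have e: "of_bool (norm (velocity l y) \<le> M) * (norm (velocity l y))\<^sup>2 * mix l y
      = (\<Sum>i\<in>UNIV. (g i y)\<^sup>2 * mix l y)" for y
    unfolding g_def power2_norm_vec by (simp add: power_mult_distrib sum_distrib_left sum_distrib_right)
  have i: "integrable lborel (\<lambda>y. (g i y)\<^sup>2 * mix l y)" for i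
    by (rule integral_smear_gauss(1)[OF g2])
  have "(\<integral>\<^sup>+y. ennreal (\<Sum>i\<in>UNIV. (g i y)\<^sup>2 * mix l y) \<partial>lborel) = ennreal w"
    unfolding w_def using i mix_pos
    by (subst nn_integral_eq_integral) (auto intro!: sum_nonneg mult_nonneg_nonneg less_imp_le[OF mix_pos])
  then show ?thesis using \<open>w \<le> c * l\<^sup>2 * s\<close> unfolding e s_def by (simp add: ennreal_leI)
qed

text \<open>The truncated bound does not depend on the level \<open>M\<close>, so monotone
  convergence removes the cutoff. Finiteness of the integral is part of the conclusion.\<close>

lemma velocity_bound:
  assumes P: "poincare_constant \<mu> < ennreal c" "c \<ge> 0"
    and cent: "\<And>i. (\<integral>x. x $ i \<partial>\<mu>) = 0" and l: "\<bar>l\<bar> \<le> 1"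
  shows "(\<integral>\<^sup>+y. ennreal ((norm (velocity l y))\<^sup>2 * mix l y) \<partial>lborel)
    \<le> ennreal (c * l\<^sup>2 * (\<integral>x. (norm x)\<^sup>2 \<partial>\<mu>))"
proof -
  define f where "f M y = ennreal (of_bool (norm (velocity l y) \<le> real M) * (norm (velocity l y))\<^sup>2 * mix l y)" for M y
  have [measurable]: "f M \<in> borel_measurable borel" for M unfolding f_def by measurable
  have inc: "incseq f"
    unfolding f_def incseq_def le_fun_def
    by (intro allI impI ennreal_leI mult_right_mono) (simp_all add: less_imp_le[OF mix_pos] order_trans)
  have lim: "(\<lambda>M. f M y) \<longlonglongrightarrow> ennreal ((norm (velocity l y))\<^sup>2 * mix l y)" for y
  proof (rule tendsto_eventually)
    have "eventually (\<lambda>M. norm (velocity l y) \<le> real M) sequentially"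
      using eventually_ge_at_top[of "nat \<lceil>norm (velocity l y)\<rceil>"]
      by eventually_elim linarith
    then show "eventually (\<lambda>M. f M y = ennreal ((norm (velocity l y))\<^sup>2 * mix l y)) sequentially"
      by eventually_elim (simp add: f_def)
  qed
  have "(\<lambda>M. \<integral>\<^sup>+y. f M y \<partial>lborel) \<longlonglongrightarrow> (\<integral>\<^sup>+y. ennreal ((norm (velocity l y))\<^sup>2 * mix l y) \<partial>lborel)"
    using inc lim by (intro nn_integral_LIMSEQ) auto
  then show ?thesis
    by (rule LIMSEQ_le_const2) (use truncated_velocity_bound[OF assms] in \<open>auto simp: f_def\<close>)
qed

subsection \<open>The resampling chain\<close>

text \<open>The law of l X + Z, leading from \<open>std_gaussian\<close> at 0 to
  \<open>\<mu> \<star> std_gaussian\<close> at 1.\<close>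

definition interp :: "real \<Rightarrow> (real ^ 'n) measure" where
  "interp l = density lborel (\<lambda>y. ennreal (mix l y))"

lemma sets_interp [simp, measurable_cong]: "sets (interp l) = sets borel"
  and space_interp [simp]: "space (interp l) = UNIV"
  unfolding interp_def by simp_all

text \<open>The conditional law of X given l X + Z = y, as a density in \<open>x\<close> with
  respect to \<open>\<mu>\<close> rather than Lebesgue measure.\<close>

definition posterior :: "real \<Rightarrow> real ^ 'n \<Rightarrow> real ^ 'n \<Rightarrow> real" where
  "posterior l y x = gauss (y - l *\<^sub>R x) / mix l y"

lemma posterior_nonneg [simp]: "posterior l y x \<ge> 0"
  unfolding posterior_def using mix_pos[of l y] by simp

lemma measurable_posterior [measurable (raw)]:
  assumes [measurable]: "f \<in> borel_measurable M" "g \<in> borel_measurable M"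
  shows "(\<lambda>z. posterior l (f z) (g z)) \<in> borel_measurable M"
  unfolding posterior_def by measurable

lemma integral_posterior: "(\<integral>x. posterior l y x \<partial>\<mu>) = 1"
  using mix_pos[of l y] unfolding posterior_def by (simp add: mix_def)

lemma integral_nth_posterior:
  "integrable \<mu> (\<lambda>x. x $ i * posterior l y x)" "(\<integral>x. x $ i * posterior l y x \<partial>\<mu>) = velocity l y $ i"
  unfolding posterior_def velocity_def using integrable_nth_gauss[of i y l] by simp_all

lemma integrable_posterior: "integrable \<mu> (posterior l y)"
  unfolding posterior_def using integrable_gauss_mix[of y l] by simp

lemma integrable_square_posterior: "integrable \<mu> (\<lambda>x. (norm x)\<^sup>2 * posterior l y x)"
  unfolding posterior_def using integrable_square_gauss[of y l] by simp

text \<open>\<open>mix\<close> times \<open>posterior\<close> is the Gaussian kernel, so Tonelli and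
  a translation suffice. In probabilistic terms, a signal redrawn given Y_l has, jointly with Y_l,
  the law of the original pair; this makes the chain exact.\<close>

lemma nn_integral_posterior_interp:
  assumes [measurable]: "(\<lambda>(y, x). K y x) \<in> borel_measurable (borel \<Otimes>\<^sub>M borel)"
  shows "(\<integral>\<^sup>+y. (\<integral>\<^sup>+x. K y x * ennreal (posterior l y x) \<partial>\<mu>) \<partial>interp l)
      = (\<integral>\<^sup>+x. (\<integral>\<^sup>+z. K (z + l *\<^sub>R x) x * ennreal (gauss z) \<partial>lborel) \<partial>\<mu>)"
proof -
  interpret P: pair_sigma_finite "lborel :: (real ^ 'n) measure" \<mu> ..
  have [measurable]: "(\<lambda>x. K (f x) (g x)) \<in> borel_measurable M"
    if [measurable]: "f \<in> borel_measurable M" "g \<in> borel_measurable M" for f g and M :: "((real ^ 'n) \<times> (real ^ 'n)) measure"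
    using measurable_compose[OF measurable_Pair[OF that] assms] by simp
  have [measurable]: "(\<lambda>x. K (f x) (g x)) \<in> borel_measurable M"
    if [measurable]: "f \<in> borel_measurable M" "g \<in> borel_measurable M" for f g and M :: "(real ^ 'n) measure"
    using measurable_compose[OF measurable_Pair[OF that] assms] by simp
  have "(\<integral>\<^sup>+y. (\<integral>\<^sup>+x. K y x * ennreal (posterior l y x) \<partial>\<mu>) \<partial>interp l)
      = (\<integral>\<^sup>+y. ennreal (mix l y) * (\<integral>\<^sup>+x. K y x * ennreal (posterior l y x) \<partial>\<mu>) \<partial>lborel)"
    unfolding interp_def by (subst nn_integral_density) simp_all
  also have "\<dots> = (\<integral>\<^sup>+y. (\<integral>\<^sup>+x. K y x * ennreal (gauss (y - l *\<^sub>R x)) \<partial>\<mu>) \<partial>lborel)"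
  proof (rule nn_integral_cong)
    fix y
    have "ennreal (mix l y) * (\<integral>\<^sup>+x. K y x * ennreal (posterior l y x) \<partial>\<mu>)
        = (\<integral>\<^sup>+x. ennreal (mix l y) * (K y x * ennreal (posterior l y x)) \<partial>\<mu>)"
      by (rule nn_integral_cmult[symmetric]) measurable
    also have "\<dots> = (\<integral>\<^sup>+x. K y x * ennreal (gauss (y - l *\<^sub>R x)) \<partial>\<mu>)"
    proof (rule nn_integral_cong)
      fix x
      have "ennreal (mix l y) * ennreal (posterior l y x) = ennreal (gauss (y - l *\<^sub>R x))"
        using mix_pos[of l y] by (simp add: ennreal_mult[symmetric] less_imp_le) (simp add: posterior_def)
      then show "ennreal (mix l y) * (K y x * ennreal (posterior l y x)) = K y x * ennreal (gauss (y - l *\<^sub>R x))"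
        by (metis mult.left_commute)
    qed
    finally show "ennreal (mix l y) * (\<integral>\<^sup>+x. K y x * ennreal (posterior l y x) \<partial>\<mu>)
        = (\<integral>\<^sup>+x. K y x * ennreal (gauss (y - l *\<^sub>R x)) \<partial>\<mu>)" .
  qed
  also have "\<dots> = (\<integral>\<^sup>+x. (\<integral>\<^sup>+y. K y x * ennreal (gauss (y - l *\<^sub>R x)) \<partial>lborel) \<partial>\<mu>)"
    by (rule P.Fubini'[symmetric]) measurable
  also have "\<dots> = (\<integral>\<^sup>+x. (\<integral>\<^sup>+z. K (z + l *\<^sub>R x) x * ennreal (gauss z) \<partial>lborel) \<partial>\<mu>)"
  proof (rule nn_integral_cong)
    fix x
    show "(\<integral>\<^sup>+y. K y x * ennreal (gauss (y - l *\<^sub>R x)) \<partial>lborel)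
        = (\<integral>\<^sup>+z. K (z + l *\<^sub>R x) x * ennreal (gauss z) \<partial>lborel)"
      by (subst nn_integral_lborel_shift[of _ "l *\<^sub>R x", symmetric]) (simp_all add: add.commute)
  qed
  finally show ?thesis .
qed

lemma nn_integral_posterior: "(\<integral>\<^sup>+x. ennreal (posterior l y x) \<partial>\<mu>) = 1"
  by (subst nn_integral_eq_integral) (auto simp: integrable_posterior integral_posterior)

lemma nn_integral_interp:
  assumes [measurable]: "f \<in> borel_measurable borel"
  shows "(\<integral>\<^sup>+y. f y \<partial>interp l) = (\<integral>\<^sup>+x. (\<integral>\<^sup>+z. f (z + l *\<^sub>R x) * ennreal (gauss z) \<partial>lborel) \<partial>\<mu>)"
proof -
  have "(\<integral>\<^sup>+x. f y * ennreal (posterior l y x) \<partial>\<mu>) = f y" for y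
    by (subst nn_integral_cmult) (simp_all add: nn_integral_posterior)
  then show ?thesis
    using nn_integral_posterior_interp[of "\<lambda>y x. f y" l] by simp
qed

lemma prob_space_interp: "prob_space (interp l)"
proof
  have "emeasure (interp l) (space (interp l)) = (\<integral>\<^sup>+y. 1 \<partial>interp l)" by simp
  also have "\<dots> = 1"
    by (subst nn_integral_interp) (simp_all add: nn_integral_gauss emeasure_space_1)
  finally show "emeasure (interp l) (space (interp l)) = 1" .
qed

lemma interp_0: "interp 0 = std_gaussian"
proof -
  have "mix 0 y = gauss y" for y unfolding mix_def by (simp add: prob_space)
  then show ?thesis
    unfolding interp_def std_gaussian_def gauss_def by simp
qed

lemma interp_1: "interp 1 = (\<mu> \<star> std_gaussian)"
proof (rule measure_eqI)
  interpret G: prob_space "std_gaussian :: (real ^ 'n) measure"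
    using prob_space_interp[of 0] unfolding interp_0 .
  have sg[measurable_cong]: "sets (std_gaussian :: (real ^ 'n) measure) = sets borel"
    unfolding std_gaussian_def by simp
  have dg: "(std_gaussian :: (real ^ 'n) measure) = density lborel (\<lambda>z. ennreal (gauss z))"
    unfolding std_gaussian_def gauss_def by simp
  show "sets (interp 1) = sets (\<mu> \<star> std_gaussian)" by simp
  fix A assume "A \<in> sets (interp 1)"
  then have [measurable]: "A \<in> sets borel" by simp
  have "emeasure (\<mu> \<star> std_gaussian) A = (\<integral>\<^sup>+y. indicator A y \<partial>(\<mu> \<star> std_gaussian))"
    by simp
  also have "\<dots> = (\<integral>\<^sup>+p. indicator A (fst p + snd p) \<partial>(\<mu> \<Otimes>\<^sub>M std_gaussian))"
    unfolding convolution_def by (subst nn_integral_distr) (simp_all add: case_prod_unfold)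
  also have "\<dots> = (\<integral>\<^sup>+x. (\<integral>\<^sup>+z. indicator A (x + z) \<partial>std_gaussian) \<partial>\<mu>)"
    by (subst G.nn_integral_fst[symmetric]) simp_all
  also have "\<dots> = (\<integral>\<^sup>+x. (\<integral>\<^sup>+z. indicator A (z + 1 *\<^sub>R x) * ennreal (gauss z) \<partial>lborel) \<partial>\<mu>)"
    unfolding dg by (subst nn_integral_density) (simp_all add: add.commute mult.commute)
  also have "\<dots> = (\<integral>\<^sup>+y. indicator A y \<partial>interp 1)"
    by (subst nn_integral_interp) simp_all
  finally show "emeasure (interp 1) A = emeasure (\<mu> \<star> std_gaussian) A" by simp
qed

text \<open>One step of the chain from the displacement \<open>a\<close>. Expanding the square, the
  cross term is \<open>2 * d\<close> times the inner product of \<open>a\<close> with the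
  conditional mean, which is split by Young's inequality. The term in \<open>d\<^sup>2\<close> is
  left as a posterior moment, to be averaged later.\<close>

lemma posterior_square_bound:
  assumes d: "d \<ge> 0"
  shows "(\<integral>\<^sup>+x. ennreal ((norm (a + d *\<^sub>R x))\<^sup>2) * ennreal (posterior l y x) \<partial>\<mu>)
    \<le> ennreal ((1 + d) * (norm a)\<^sup>2) + ennreal (d * (norm (velocity l y))\<^sup>2)
      + (\<integral>\<^sup>+x. ennreal (d\<^sup>2 * (norm x)\<^sup>2) * ennreal (posterior l y x) \<partial>\<mu>)"
proof -
  let ?q = "posterior l y"
  define R where "R = (\<integral>x. (norm x)\<^sup>2 * ?q x \<partial>\<mu>)"
  have R0: "R \<ge> 0" unfolding R_def by simp
  note ii = integrable_posterior[of l y] integral_nth_posterior(1)[of _ l y] integrable_square_posterior[of l y]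
  have ex: "(norm (a + d *\<^sub>R x))\<^sup>2 * ?q x
     = (norm a)\<^sup>2 * ?q x + (2 * d) * (\<Sum>i\<in>UNIV. a $ i * (x $ i * ?q x)) + d\<^sup>2 * ((norm x)\<^sup>2 * ?q x)" for x
  proof -
    have "(norm (a + d *\<^sub>R x))\<^sup>2 = (norm a)\<^sup>2 + 2 * d * (a \<bullet> x) + d\<^sup>2 * (norm x)\<^sup>2"
      unfolding power2_norm_eq_inner
      by (simp add: inner_add_left inner_add_right inner_commute power2_eq_square algebra_simps)
    moreover have "a \<bullet> x = (\<Sum>i\<in>UNIV. a $ i * x $ i)" by (simp add: inner_vec_def)
    ultimately show ?thesis by (simp add: algebra_simps sum_distrib_left sum_distrib_right)
  qed
  have i0: "integrable \<mu> (\<lambda>x. (norm (a + d *\<^sub>R x))\<^sup>2 * ?q x)"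
    unfolding ex using ii by (intro Bochner_Integration.integrable_add integrable_mult_right Bochner_Integration.integrable_sum) auto
  have "(\<integral>x. (norm (a + d *\<^sub>R x))\<^sup>2 * ?q x \<partial>\<mu>) = (norm a)\<^sup>2 + 2 * d * (a \<bullet> velocity l y) + d\<^sup>2 * R"
    unfolding ex R_def inner_vec_def using ii
    by (simp add: integral_posterior integral_nth_posterior(2))
  also have "\<dots> \<le> (1 + d) * (norm a)\<^sup>2 + d * (norm (velocity l y))\<^sup>2 + d\<^sup>2 * R"
  proof -
    have "0 \<le> (norm (a - velocity l y))\<^sup>2" by simp
    also have "\<dots> = (norm a)\<^sup>2 + (norm (velocity l y))\<^sup>2 - 2 * (a \<bullet> velocity l y)"
      unfolding power2_norm_eq_inner by (simp add: inner_diff_left inner_diff_right inner_commute)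
    finally have "d * (2 * (a \<bullet> velocity l y)) \<le> d * ((norm a)\<^sup>2 + (norm (velocity l y))\<^sup>2)"
      using d by (intro mult_left_mono) auto
    then show ?thesis by (simp add: algebra_simps)
  qed
  finally have le: "(\<integral>x. (norm (a + d *\<^sub>R x))\<^sup>2 * ?q x \<partial>\<mu>)
      \<le> (1 + d) * (norm a)\<^sup>2 + d * (norm (velocity l y))\<^sup>2 + d\<^sup>2 * R" .
  have "(\<integral>\<^sup>+x. ennreal ((norm (a + d *\<^sub>R x))\<^sup>2) * ennreal (?q x) \<partial>\<mu>)
      = ennreal (\<integral>x. (norm (a + d *\<^sub>R x))\<^sup>2 * ?q x \<partial>\<mu>)"
    by (subst nn_integral_eq_integral[OF i0, symmetric]) (simp_all add: ennreal_mult)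
  also have "\<dots> \<le> ennreal ((1 + d) * (norm a)\<^sup>2 + d * (norm (velocity l y))\<^sup>2 + d\<^sup>2 * R)"
    using le by (rule ennreal_leI)
  also have "\<dots> = ennreal ((1 + d) * (norm a)\<^sup>2) + ennreal (d * (norm (velocity l y))\<^sup>2) + ennreal (d\<^sup>2 * R)"
    using d R0 by simp
  also have "ennreal (d\<^sup>2 * R) = (\<integral>\<^sup>+x. ennreal (d\<^sup>2 * (norm x)\<^sup>2) * ennreal (?q x) \<partial>\<mu>)"
  proof -
    have "ennreal (d\<^sup>2 * R) = ennreal (\<integral>x. d\<^sup>2 * ((norm x)\<^sup>2 * ?q x) \<partial>\<mu>)"
      unfolding R_def by simp
    also have "\<dots> = (\<integral>\<^sup>+x. ennreal (d\<^sup>2 * ((norm x)\<^sup>2 * ?q x)) \<partial>\<mu>)"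
      using ii by (intro nn_integral_eq_integral[symmetric]) auto
    finally show ?thesis by (simp add: ennreal_mult mult.assoc)
  qed
  finally show ?thesis .
qed

text \<open>The tower property: averaging posterior second moments over Y_l returns the second
  moment of \<open>\<mu>\<close>.\<close>

lemma nn_integral_square_posterior_interp:
  "(\<integral>\<^sup>+y. (\<integral>\<^sup>+x. ennreal (d\<^sup>2 * (norm x)\<^sup>2) * ennreal (posterior l y x) \<partial>\<mu>) \<partial>interp l)
    = ennreal (d\<^sup>2 * (\<integral>x. (norm x)\<^sup>2 \<partial>\<mu>))"
proof -
  have "(\<integral>\<^sup>+y. (\<integral>\<^sup>+x. ennreal (d\<^sup>2 * (norm x)\<^sup>2) * ennreal (posterior l y x) \<partial>\<mu>) \<partial>interp l)
    = (\<integral>\<^sup>+x. ennreal (d\<^sup>2 * (norm x)\<^sup>2) \<partial>\<mu>)"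
    by (subst nn_integral_posterior_interp) (simp_all add: nn_integral_cmult nn_integral_gauss)
  also have "\<dots> = ennreal (\<integral>x. d\<^sup>2 * (norm x)\<^sup>2 \<partial>\<mu>)"
    using square_integrable by (intro nn_integral_eq_integral) auto
  finally show ?thesis by simp
qed

text \<open>One step of the chain, recording only the joint law of the moving point (first
  coordinate) and the fixed starting point (second). Since the posterior has a density, a weighted
  product with \<open>\<mu>\<close> takes the place of a Markov kernel.\<close>

definition resample ::
  "real \<Rightarrow> real \<Rightarrow> ((real ^ 'n) \<times> (real ^ 'n)) measure \<Rightarrow> ((real ^ 'n) \<times> (real ^ 'n)) measure" where
  "resample l d \<tau> = distr (density (\<tau> \<Otimes>\<^sub>M \<mu>) (\<lambda>p. ennreal (posterior l (fst (fst p)) (snd p))))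
     (borel \<Otimes>\<^sub>M borel) (\<lambda>p. (fst (fst p) + d *\<^sub>R snd p, snd (fst p)))"

lemma sets_resample [simp]: "sets (resample l d \<tau>) = sets (borel \<Otimes>\<^sub>M borel)"
  unfolding resample_def by simp

lemma nn_integral_resample:
  assumes \<tau> [measurable_cong]: "sets \<tau> = sets (borel \<Otimes>\<^sub>M borel)"
    and [measurable]: "F \<in> borel_measurable (borel \<Otimes>\<^sub>M borel)"
  shows "(\<integral>\<^sup>+p. F p \<partial>resample l d \<tau>)
    = (\<integral>\<^sup>+z. (\<integral>\<^sup>+x. F (fst z + d *\<^sub>R x, snd z) * ennreal (posterior l (fst z) x) \<partial>\<mu>) \<partial>\<tau>)"
proof -
  have "(\<integral>\<^sup>+p. F p \<partial>resample l d \<tau>)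
    = (\<integral>\<^sup>+p. ennreal (posterior l (fst (fst p)) (snd p)) * F (fst (fst p) + d *\<^sub>R snd p, snd (fst p)) \<partial>(\<tau> \<Otimes>\<^sub>M \<mu>))"
    unfolding resample_def by (subst nn_integral_distr, simp, simp) (subst nn_integral_density, simp_all)
  also have "\<dots> = (\<integral>\<^sup>+z. (\<integral>\<^sup>+x. ennreal (posterior l (fst z) x) * F (fst z + d *\<^sub>R x, snd z) \<partial>\<mu>) \<partial>\<tau>)"
    by (subst nn_integral_fst[symmetric]) simp_all
  finally show ?thesis by (simp only: mult.commute)
qed

section \<open>Marginals and quadratic cost after one resampling step\<close>

lemma nn_integral_marginal:
  assumes "distr \<tau> borel f = \<nu>" "f \<in> borel_measurable \<tau>" "h \<in> borel_measurable borel"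
  shows "(\<integral>\<^sup>+z. h (f z) \<partial>\<tau>) = (\<integral>\<^sup>+y. h y \<partial>\<nu>)"
  unfolding assms(1)[symmetric] using assms(2,3) by (simp add: nn_integral_distr)

text \<open>There is no discretisation error: the current point and the redrawn signal are
  distributed as z + l x and x, so adding d x yields z + (l + d) x.\<close>

lemma resample_fst:
  assumes \<tau> [measurable_cong]: "sets \<tau> = sets (borel \<Otimes>\<^sub>M borel)"
    and fst: "distr \<tau> borel fst = interp l"
  shows "distr (resample l d \<tau>) borel fst = interp (l + d)"
proof (rule measure_eqI)
  fix A assume "A \<in> sets (distr (resample l d \<tau>) borel fst)"
  then have [measurable]: "A \<in> sets borel" by simp
  have m: "fst \<in> borel_measurable (resample l d \<tau>)"
    unfolding measurable_cong_sets[OF sets_resample refl] by simp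
  have "emeasure (distr (resample l d \<tau>) borel fst) A = (\<integral>\<^sup>+y. indicator A y \<partial>distr (resample l d \<tau>) borel fst)"
    by simp
  also have "\<dots> = (\<integral>\<^sup>+p. indicator A (fst p) \<partial>resample l d \<tau>)"
    using m by (subst nn_integral_distr) simp_all
  also have "\<dots> = (\<integral>\<^sup>+z. (\<integral>\<^sup>+x. indicator A (fst z + d *\<^sub>R x) * ennreal (posterior l (fst z) x) \<partial>\<mu>) \<partial>\<tau>)"
    by (subst nn_integral_resample[OF \<tau>]) simp_all
  also have "\<dots> = (\<integral>\<^sup>+y. (\<integral>\<^sup>+x. indicator A (y + d *\<^sub>R x) * ennreal (posterior l y x) \<partial>\<mu>) \<partial>interp l)"
    by (rule nn_integral_marginal[OF fst]) simp_all
  also have "\<dots> = (\<integral>\<^sup>+x. (\<integral>\<^sup>+z. indicator A (z + (l + d) *\<^sub>R x) * ennreal (gauss z) \<partial>lborel) \<partial>\<mu>)"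
    by (subst nn_integral_posterior_interp) (simp_all add: scaleR_add_left add.assoc)
  also have "\<dots> = (\<integral>\<^sup>+y. indicator A y \<partial>interp (l + d))"
    by (subst nn_integral_interp) simp_all
  finally show "emeasure (distr (resample l d \<tau>) borel fst) A = emeasure (interp (l + d)) A" by simp
qed simp

lemma resample_snd:
  assumes \<tau> [measurable_cong]: "sets \<tau> = sets (borel \<Otimes>\<^sub>M borel)"
  shows "distr (resample l d \<tau>) borel snd = distr \<tau> borel snd"
proof (rule measure_eqI)
  fix A assume "A \<in> sets (distr (resample l d \<tau>) borel snd)"
  then have [measurable]: "A \<in> sets borel" by simp
  have m: "snd \<in> borel_measurable (resample l d \<tau>)"
    unfolding measurable_cong_sets[OF sets_resample refl] by simp
  have "emeasure (distr (resample l d \<tau>) borel snd) A = (\<integral>\<^sup>+y. indicator A y \<partial>distr (resample l d \<tau>) borel snd)"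
    by simp
  also have "\<dots> = (\<integral>\<^sup>+p. indicator A (snd p) \<partial>resample l d \<tau>)"
    using m by (subst nn_integral_distr) simp_all
  also have "\<dots> = (\<integral>\<^sup>+z. (\<integral>\<^sup>+x. indicator A (snd z) * ennreal (posterior l (fst z) x) \<partial>\<mu>) \<partial>\<tau>)"
    by (subst nn_integral_resample[OF \<tau>]) simp_all
  also have "\<dots> = (\<integral>\<^sup>+z. indicator A (snd z) \<partial>\<tau>)"
    by (simp add: nn_integral_cmult nn_integral_posterior)
  also have "\<dots> = (\<integral>\<^sup>+y. indicator A y \<partial>distr \<tau> borel snd)"
    by (subst nn_integral_distr) simp_all
  finally show "emeasure (distr (resample l d \<tau>) borel snd) A = emeasure (distr \<tau> borel snd) A" by simp
qed simp

text \<open>\<open>posterior_square_bound\<close> averaged over \<open>\<tau>\<close>. Its last two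
  terms depend on the first coordinate only, whose law is \<open>interp l\<close>, so
  \<open>velocity_bound\<close> and the tower property apply whatever the dependence on the second
  coordinate.\<close>

lemma resample_cost:
  assumes P: "poincare_constant \<mu> < ennreal c" "c \<ge> 0"
    and cent: "\<And>i. (\<integral>x. x $ i \<partial>\<mu>) = 0" and l: "\<bar>l\<bar> \<le> 1" and d: "d \<ge> 0"
    and \<tau> [measurable_cong]: "sets \<tau> = sets (borel \<Otimes>\<^sub>M borel)"
    and fst: "distr \<tau> borel fst = interp l"
    and b: "(\<integral>\<^sup>+p. ennreal ((norm (fst p - snd p))\<^sup>2) \<partial>\<tau>) \<le> ennreal b" "b \<ge> 0"
  shows "(\<integral>\<^sup>+p. ennreal ((norm (fst p - snd p))\<^sup>2) \<partial>resample l d \<tau>)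
    \<le> ennreal ((1 + d) * b + d * (c * l\<^sup>2 * (\<integral>x. (norm x)\<^sup>2 \<partial>\<mu>)) + d\<^sup>2 * (\<integral>x. (norm x)\<^sup>2 \<partial>\<mu>))"
proof -
  define s where "s = (\<integral>x. (norm x)\<^sup>2 \<partial>\<mu>)"
  have s: "s \<ge> 0" unfolding s_def by simp
  let ?R = "\<lambda>y. \<integral>\<^sup>+x. ennreal (d\<^sup>2 * (norm x)\<^sup>2) * ennreal (posterior l y x) \<partial>\<mu>"
  have "(\<integral>\<^sup>+p. ennreal ((norm (fst p - snd p))\<^sup>2) \<partial>resample l d \<tau>)
    = (\<integral>\<^sup>+z. (\<integral>\<^sup>+x. ennreal ((norm ((fst z - snd z) + d *\<^sub>R x))\<^sup>2) * ennreal (posterior l (fst z) x) \<partial>\<mu>) \<partial>\<tau>)"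
    by (subst nn_integral_resample[OF \<tau>]) (simp_all add: algebra_simps)
  also have "\<dots> \<le> (\<integral>\<^sup>+z. ennreal ((1 + d) * (norm (fst z - snd z))\<^sup>2)
      + ennreal (d * (norm (velocity l (fst z)))\<^sup>2) + ?R (fst z) \<partial>\<tau>)"
    by (intro nn_integral_mono posterior_square_bound d)
  also have "\<dots> = (\<integral>\<^sup>+z. ennreal ((1 + d) * (norm (fst z - snd z))\<^sup>2) \<partial>\<tau>)
      + (\<integral>\<^sup>+z. ennreal (d * (norm (velocity l (fst z)))\<^sup>2) \<partial>\<tau>) + (\<integral>\<^sup>+z. ?R (fst z) \<partial>\<tau>)"
    by (subst nn_integral_add, simp, simp)+ simp
  also have "(\<integral>\<^sup>+z. ?R (fst z) \<partial>\<tau>) = ennreal (d\<^sup>2 * s)"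
    unfolding s_def by (subst nn_integral_marginal[OF fst]) (simp_all add: nn_integral_square_posterior_interp)
  also have "(\<integral>\<^sup>+z. ennreal ((1 + d) * (norm (fst z - snd z))\<^sup>2) \<partial>\<tau>) \<le> ennreal ((1 + d) * b)"
    using d b by (simp add: ennreal_mult nn_integral_cmult mult_left_mono)
  also have "(\<integral>\<^sup>+z. ennreal (d * (norm (velocity l (fst z)))\<^sup>2) \<partial>\<tau>) \<le> ennreal (d * (c * l\<^sup>2 * s))"
  proof -
    have "(\<integral>\<^sup>+z. ennreal (d * (norm (velocity l (fst z)))\<^sup>2) \<partial>\<tau>)
      = ennreal d * (\<integral>\<^sup>+z. ennreal ((norm (velocity l (fst z)))\<^sup>2) \<partial>\<tau>)"
      using d by (simp add: ennreal_mult nn_integral_cmult)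
    also have "(\<integral>\<^sup>+z. ennreal ((norm (velocity l (fst z)))\<^sup>2) \<partial>\<tau>)
        = (\<integral>\<^sup>+y. ennreal ((norm (velocity l y))\<^sup>2) \<partial>interp l)"
      by (rule nn_integral_marginal[OF fst]) simp_all
    also have "\<dots> = (\<integral>\<^sup>+y. ennreal ((norm (velocity l y))\<^sup>2 * mix l y) \<partial>lborel)"
      unfolding interp_def using mix_pos
      by (subst nn_integral_density) (simp_all add: ennreal_mult less_imp_le mult.commute)
    also have "\<dots> \<le> ennreal (c * l\<^sup>2 * s)"
      unfolding s_def by (rule velocity_bound[OF P cent l])
    finally show ?thesis using d P(2) s by (simp add: ennreal_mult mult_left_mono)
  qed
  finally show ?thesis
    unfolding s_def[symmetric] using d b P(2) s by (simp add: add_mono)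
qed

text \<open>The grid points are \<open>k / N\<close>. Each resampling step multiplies the cost by \<open>1 + 1 / N\<close> and
  adds two terms; the bound claimed is the solution of a majorant of this recursion.\<close>
lemma coupling_chain:
  assumes P: "poincare_constant \<mu> < ennreal c" "c \<ge> 0"
    and cent: "\<And>i. (\<integral>x. x $ i \<partial>\<mu>) = 0" and N: "N > 0" and k: "k \<le> N"
  defines "s \<equiv> \<integral>x. (norm x)\<^sup>2 \<partial>\<mu>" and "d \<equiv> 1 / real N"
  shows "\<exists>\<tau>. sets \<tau> = sets (borel \<Otimes>\<^sub>M borel) \<and> distr \<tau> borel fst = interp (real k * d)
    \<and> distr \<tau> borel snd = interp 0
    \<and> (\<integral>\<^sup>+p. ennreal ((norm (fst p - snd p))\<^sup>2) \<partial>\<tau>)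
        \<le> ennreal (c * s * (real k * d)\<^sup>2 + s * d * ((1 + d) ^ k - 1))"
  using k
proof (induction k)
  case 0
  let ?\<tau> = "distr (interp 0) (borel \<Otimes>\<^sub>M borel) (\<lambda>y. (y, y))"
  have "(\<integral>\<^sup>+p. ennreal ((norm (fst p - snd p))\<^sup>2) \<partial>?\<tau>) = 0"
    by (subst nn_integral_distr) simp_all
  moreover have "distr ?\<tau> borel fst = interp 0" "distr ?\<tau> borel snd = interp 0"
    by (simp_all add: distr_distr comp_def distr_id2)
  ultimately show ?case by (intro exI[of _ ?\<tau>]) simp
next
  case (Suc k)
  have s: "s \<ge> 0" unfolding s_def by simp
  have d: "d \<ge> 0" unfolding d_def by simp
  define l where "l = real k * d"
  have l: "0 \<le> l" "l \<le> 1" unfolding l_def d_def using Suc.prems by (auto simp: divide_le_eq_1)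
  define E where "E = (1 + d) ^ k - 1"
  have E: "E \<ge> 0" unfolding E_def using d by (simp add: one_le_power)
  obtain \<tau> where \<tau>: "sets \<tau> = sets (borel \<Otimes>\<^sub>M borel)" "distr \<tau> borel fst = interp l"
      "distr \<tau> borel snd = interp 0"
      "(\<integral>\<^sup>+p. ennreal ((norm (fst p - snd p))\<^sup>2) \<partial>\<tau>) \<le> ennreal (c * s * l\<^sup>2 + s * d * E)"
    using Suc unfolding l_def E_def by auto
  have b0: "c * s * l\<^sup>2 + s * d * E \<ge> 0" using s d E P(2) by simp
  have "\<bar>l\<bar> \<le> 1" using l by simp
  note cost = resample_cost[OF P cent this d \<tau>(1,2,4) b0, folded s_def]
  \<comment> \<open>One \<open>d * l\<^sup>2\<close> comes from the factor \<open>1 + d\<close>, the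
    other from the conditional mean. The term \<open>d\<^sup>2 * s\<close> fits the recursion for
    \<open>(1 + d) ^ k - 1\<close> exactly.\<close>
  have "(1 + d) * (c * s * l\<^sup>2 + s * d * E) + d * (c * l\<^sup>2 * s) + d\<^sup>2 * s
      = c * s * (l\<^sup>2 + 2 * d * l\<^sup>2) + s * d * ((1 + d) ^ Suc k - 1)"
    unfolding E_def by (simp add: power2_eq_square algebra_simps)
  also have "\<dots> \<le> c * s * (real (Suc k) * d)\<^sup>2 + s * d * ((1 + d) ^ Suc k - 1)"
  proof -
    \<comment> \<open>This is where \<open>l \<le> 1\<close> enters: the growth
      \<open>2 * d * l\<^sup>2\<close> is at most the cross term of
      \<open>(l + d)\<^sup>2\<close>.\<close>
    have "l\<^sup>2 \<le> l" using l by (simp add: power2_eq_square mult_left_le_one_le)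
    then have "2 * d * l\<^sup>2 \<le> 2 * d * l" using d by (intro mult_left_mono) auto
    moreover have "2 * d * l = 2 * l * d" by simp
    ultimately have "l\<^sup>2 + 2 * d * l\<^sup>2 \<le> (l + d)\<^sup>2" unfolding power2_sum using zero_le_power2[of d]
      by linarith
    also have "l + d = real (Suc k) * d" unfolding l_def by (simp add: algebra_simps)
    finally show ?thesis using s P(2) by (intro add_right_mono mult_left_mono) auto
  qed
  finally have "(\<integral>\<^sup>+p. ennreal ((norm (fst p - snd p))\<^sup>2) \<partial>resample l d \<tau>)
     \<le> ennreal (c * s * (real (Suc k) * d)\<^sup>2 + s * d * ((1 + d) ^ Suc k - 1))"
    using cost ennreal_leI order_trans by blast
  moreover have "distr (resample l d \<tau>) borel fst = interp (real (Suc k) * d)"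
    using resample_fst[OF \<tau>(1,2), of d] unfolding l_def by (simp add: algebra_simps)
  moreover have "distr (resample l d \<tau>) borel snd = interp 0"
    using resample_snd[OF \<tau>(1)] \<tau>(3) by simp
  ultimately show ?case by (intro exI[of _ "resample l d \<tau>"]) simp
qed

section \<open>From the chain to couplings and to both transport costs\<close>

lemma coupling_exists:
  assumes P: "poincare_constant \<mu> < ennreal c" "c \<ge> 0"
    and cent: "\<And>i. (\<integral>x. x $ i \<partial>\<mu>) = 0" and e: "e > 0"
  shows "\<exists>\<tau>\<in>couplings (\<mu> \<star> std_gaussian) std_gaussian.
    (\<integral>\<^sup>+p. ennreal ((norm (fst p - snd p))\<^sup>2) \<partial>\<tau>) \<le> ennreal (c * (\<integral>x. (norm x)\<^sup>2 \<partial>\<mu>) + e)"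
proof -
  define s where "s = (\<integral>x. (norm x)\<^sup>2 \<partial>\<mu>)"
  have s: "s \<ge> 0" unfolding s_def by simp
  \<comment> \<open>The threshold anticipates the error of the chain: as
    \<open>(1 + d) ^ N \<le> exp 1 \<le> 3\<close>, it is at most \<open>2 * s / N\<close>.\<close>
  obtain N :: nat where N: "real N > 2 * s / e" using reals_Archimedean2 by blast
  have N0: "N > 0" using N s e by (metis divide_nonneg_pos gr0I less_le_not_le mult_nonneg_nonneg of_nat_0 zero_le_numeral)
  define d where "d = 1 / real N"
  have Nd: "real N * d = 1" unfolding d_def using N0 by simp
  obtain \<tau> where \<tau>: "sets \<tau> = sets (borel \<Otimes>\<^sub>M borel)" "distr \<tau> borel fst = interp 1"
    "distr \<tau> borel snd = interp 0"
    "(\<integral>\<^sup>+p. ennreal ((norm (fst p - snd p))\<^sup>2) \<partial>\<tau>) \<le> ennreal (c * s + s * d * ((1 + d) ^ N - 1))"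
    using coupling_chain[OF P cent N0 order_refl, folded d_def s_def] unfolding Nd by auto
  have "(1 + d) ^ N \<le> exp (d) ^ N"
    by (intro power_mono) (simp_all add: d_def exp_ge_add_one_self)
  also have "\<dots> = exp 1" unfolding exp_of_nat_mult[symmetric] Nd ..
  also have "\<dots> \<le> 3" by (rule exp_le)
  finally have "s * d * ((1 + d) ^ N - 1) \<le> s * d * 2"
    using s by (intro mult_left_mono) (auto simp: d_def)
  also have "\<dots> \<le> e" unfolding d_def using N N0 e by (simp add: field_simps)
  finally have "(\<integral>\<^sup>+p. ennreal ((norm (fst p - snd p))\<^sup>2) \<partial>\<tau>) \<le> ennreal (c * s + e)"
    using \<tau>(4) by (meson add_left_mono ennreal_leI order_trans)
  moreover have "\<tau> \<in> couplings (\<mu> \<star> std_gaussian) std_gaussian"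
  proof -
    have "sets (interp 1 \<Otimes>\<^sub>M interp 0) = sets (borel \<Otimes>\<^sub>M borel :: ((real ^ 'n) \<times> (real ^ 'n)) measure)"
      by (intro sets_pair_measure_cong) simp_all
    \<comment> \<open>The target of \<open>distr\<close> matters only through its space and its
      measurable sets, so the marginals over \<open>borel\<close> are the ones that
      \<open>couplings\<close> asks for.\<close>
    moreover have "distr \<tau> (interp 1) fst = interp 1" "distr \<tau> (interp 0) snd = interp 0"
      unfolding \<tau>(2,3)[symmetric] by (auto intro!: distr_cong)
    ultimately show ?thesis unfolding couplings_def using \<tau>(1) by (simp add: interp_0 interp_1)
  qed
  ultimately show ?thesis unfolding s_def by blast
qed

lemma prob_space_coupling:
  assumes "\<tau> \<in> couplings (\<mu> \<star> std_gaussian) std_gaussian"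
  shows "prob_space \<tau>"
proof (rule prob_space_distrD)
  have s: "sets \<tau> = sets ((\<mu> \<star> std_gaussian) \<Otimes>\<^sub>M std_gaussian)"
    and d: "distr \<tau> std_gaussian snd = std_gaussian"
    using assms unfolding couplings_def by auto
  show "snd \<in> measurable \<tau> std_gaussian"
    unfolding measurable_cong_sets[OF s refl] by simp
  show "prob_space (distr \<tau> std_gaussian snd)"
    unfolding d by (rule prob_space_interp[of 0, unfolded interp_0])
qed

text \<open>One coupling serves both exponents. The gap between \<open>B\<close> and the bound of
  the chain is the error allowed in \<open>coupling_exists\<close>; the linear cost follows from the
  quadratic one by Young's inequality.\<close>

lemma transport_cost_bounds:
  assumes P: "poincare_constant \<mu> < ennreal c" "c \<ge> 0"
    and cent: "\<And>i. (\<integral>x. x $ i \<partial>\<mu>) = 0" and B: "c * (\<integral>x. (norm x)\<^sup>2 \<partial>\<mu>) < B"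
  shows "transport_cost 2 (\<mu> \<star> std_gaussian) std_gaussian \<le> ennreal B"
    and "transport_cost 1 (\<mu> \<star> std_gaussian) std_gaussian \<le> ennreal (sqrt B)"
proof -
  obtain \<tau> where \<tau>: "\<tau> \<in> couplings (\<mu> \<star> std_gaussian) std_gaussian"
    "(\<integral>\<^sup>+p. ennreal ((norm (fst p - snd p))\<^sup>2) \<partial>\<tau>) \<le> ennreal B"
    using coupling_exists[OF P cent, of "B - c * (\<integral>x. (norm x)\<^sup>2 \<partial>\<mu>)"] B by auto
  show "transport_cost 2 (\<mu> \<star> std_gaussian) std_gaussian \<le> ennreal B"
    unfolding transport_cost_def by (rule INF_lower2[OF \<tau>(1)]) (use \<tau>(2) in simp)
  interpret T: prob_space \<tau> by (rule prob_space_coupling[OF \<tau>(1)])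
  have sets: "sets \<tau> = sets (borel \<Otimes>\<^sub>M borel)"
  proof -
    have "sets (interp 1 \<Otimes>\<^sub>M interp 0) = sets (borel \<Otimes>\<^sub>M borel :: ((real ^ 'n) \<times> (real ^ 'n)) measure)"
      by (intro sets_pair_measure_cong) simp_all
    then show ?thesis using \<tau>(1) unfolding couplings_def by (simp add: interp_0 interp_1)
  qed
  have m: "(\<lambda>p. ennreal ((norm (fst p - snd p))\<^sup>2)) \<in> borel_measurable \<tau>"
    unfolding measurable_cong_sets[OF sets refl] by measurable
  have "0 \<le> c * (\<integral>x. (norm x)\<^sup>2 \<partial>\<mu>)" using P(2) by simp
  then have B0: "B > 0" using B by linarith
  \<comment> \<open>This weight makes \<open>1 / (2 * t) * B + t / 2\<close> equal to
    \<open>sqrt B\<close>, the value that the Cauchy-Schwarz inequality would give.\<close>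
  define t where "t = sqrt B"
  have t: "t > 0" "t\<^sup>2 = B" unfolding t_def using B0 by simp_all
  have "(\<integral>\<^sup>+p. ennreal (norm (fst p - snd p) powr 1) \<partial>\<tau>)
      \<le> (\<integral>\<^sup>+p. ennreal (1 / (2 * t)) * ennreal ((norm (fst p - snd p))\<^sup>2) + ennreal (t / 2) \<partial>\<tau>)"
  proof (rule nn_integral_mono)
    fix p :: "(real ^ 'n) \<times> (real ^ 'n)"
    define r where "r = norm (fst p - snd p)"
    have "0 \<le> (r - t)\<^sup>2 / (2 * t)" using t by simp
    also have "\<dots> = 1 / (2 * t) * r\<^sup>2 + t / 2 - r"
      using t(1) by (simp add: power2_eq_square field_simps)
    finally have "r \<le> 1 / (2 * t) * r\<^sup>2 + t / 2" by simp
    then have "ennreal r \<le> ennreal (1 / (2 * t) * r\<^sup>2 + t / 2)" by (rule ennreal_leI)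
    also have "\<dots> = ennreal (1 / (2 * t)) * ennreal (r\<^sup>2) + ennreal (t / 2)"
      using t(1) by (simp add: ennreal_mult[symmetric])
    finally show "ennreal (norm (fst p - snd p) powr 1)
        \<le> ennreal (1 / (2 * t)) * ennreal ((norm (fst p - snd p))\<^sup>2) + ennreal (t / 2)"
      unfolding r_def by simp
  qed
  also have "\<dots> = ennreal (1 / (2 * t)) * (\<integral>\<^sup>+p. ennreal ((norm (fst p - snd p))\<^sup>2) \<partial>\<tau>) + ennreal (t / 2)"
    using m by (subst nn_integral_add, simp_all only: borel_measurable_const nn_integral_cmult)
      (simp_all add: T.emeasure_space_1)
  also have "\<dots> \<le> ennreal (1 / (2 * t)) * ennreal B + ennreal (t / 2)"
    using \<tau>(2) by (intro add_right_mono mult_left_mono) auto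
  also have "\<dots> = ennreal (1 / (2 * t) * B + t / 2)"
    using t(1) B0 by (simp add: ennreal_mult[symmetric])
  also have "1 / (2 * t) * B + t / 2 = t"
    unfolding t(2)[symmetric] using t(1) by (simp add: power2_eq_square field_simps)
  finally show "transport_cost 1 (\<mu> \<star> std_gaussian) std_gaussian \<le> ennreal (sqrt B)"
    unfolding transport_cost_def t_def by (rule INF_lower2[OF \<tau>(1)])
qed

end

section \<open>Removing the slack in the bounds, and the conclusion\<close>

lemma ennreal_le_of_continuous:
  fixes f :: "real \<Rightarrow> real"
  assumes "\<And>B. B > A \<Longrightarrow> x \<le> ennreal (f B)" "isCont f A"
  shows "x \<le> ennreal (f A)"
proof (rule LIMSEQ_le_const)
  have "(\<lambda>n. A + 1 / real (Suc n)) \<longlonglongrightarrow> A + 0"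
    by (intro tendsto_add tendsto_const LIMSEQ_Suc lim_1_over_n)
  then have "(\<lambda>n. f (A + 1 / real (Suc n))) \<longlonglongrightarrow> f A"
    using isCont_tendsto_compose[OF assms(2)] by simp
  then show "(\<lambda>n. ennreal (f (A + 1 / real (Suc n)))) \<longlonglongrightarrow> ennreal (f A)"
    by (rule tendsto_ennrealI)
  show "\<exists>N. \<forall>n\<ge>N. x \<le> ennreal (f (A + 1 / real (Suc n)))"
    using assms(1) by (intro exI[of _ 0]) simp
qed

lemma wasserstein_le:
  assumes "transport_cost p \<mu> \<nu> \<le> ennreal A" "A \<ge> 0" "p > 0"
  shows "wasserstein p \<mu> \<nu> \<le> ennreal (A powr (1 / p))"
proof -
  have "transport_cost p \<mu> \<nu> \<noteq> \<infinity>"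
    using assms(1) by (auto simp: top_unique)
  moreover have "enn2real (transport_cost p \<mu> \<nu>) \<le> A"
    using assms by (intro enn2real_leI) auto
  ultimately show ?thesis
    unfolding wasserstein_def using assms(3) by (simp add: ennreal_leI powr_mono2)
qed

theorem theorem2p7:
  fixes \<mu> :: "(real ^ 'n) measure"
  assumes "prob_space \<mu>"
    and "sets \<mu> = sets borel"
    and "absolutely_continuous lborel \<mu>"
    and "centred \<mu>"
    and "finite_covariance \<mu>"
    and "poincare_constant \<mu> < \<infinity>"
  shows "wasserstein 2 (\<mu> \<star> std_gaussian) std_gaussian
           \<le> ennreal (sqrt (enn2real (poincare_constant \<mu>) * trace (covariance_matrix \<mu>)))
       \<and> wasserstein 1 (\<mu> \<star> std_gaussian) std_gaussian
           \<le> ennreal (sqrt (enn2real (poincare_constant \<mu>) * trace (covariance_matrix \<mu>)))"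
proof -
  have cent: "has_bochner_integral \<mu> (\<lambda>x. x $ i) 0" for i
    using has_bochner_integral_bounded_linear[OF bounded_linear_vec_nth, of \<mu> "\<lambda>x. x" 0 i]
      assms(4) unfolding centred_def by simp
  have mean: "mean \<mu> = 0"
    using assms(4) unfolding mean_def centred_def by (rule has_bochner_integral_integral_eq)
  have i2: "integrable \<mu> (\<lambda>x. (x $ i)\<^sup>2)" for i
    using assms(5) unfolding finite_covariance_def mean by (simp add: power2_eq_square)
  interpret square_integrable_measure \<mu>
  proof (unfold square_integrable_measure_def square_integrable_measure_axioms_def, intro conjI)
    show "integrable \<mu> (\<lambda>x. (norm x)\<^sup>2)" unfolding power2_norm_vec using i2 by simp
  qed (rule assms)+
  define s where "s = (\<integral>x. (norm x)\<^sup>2 \<partial>\<mu>)"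
  define C where "C = enn2real (poincare_constant \<mu>)"
  have s: "s \<ge> 0" and C: "C \<ge> 0" unfolding s_def C_def by simp_all
  \<comment> \<open>Since the mean is zero, the trace of the covariance matrix is the second moment
    used throughout the locale.\<close>
  have tr: "trace (covariance_matrix \<mu>) = s"
    unfolding s_def power2_norm_vec trace_def covariance_matrix_def mean
    using i2 by (simp add: power2_eq_square)
  have cent': "(\<integral>x. x $ i \<partial>\<mu>) = 0" for i
    using cent by (rule has_bochner_integral_integral_eq)
  have bounds: "transport_cost 2 (\<mu> \<star> std_gaussian) std_gaussian \<le> ennreal B"
    "transport_cost 1 (\<mu> \<star> std_gaussian) std_gaussian \<le> ennreal (sqrt B)" if B: "B > C * s" for B
  proof -
    \<comment> \<open>The constant must lie strictly above \<open>C\<close> for the Poincare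
      inequality and still satisfy \<open>c * s < B\<close>. The denominator uses
      \<open>s + 1\<close> because \<open>s\<close> is only known to be nonnegative.\<close>
    define c where "c = C + (B - C * s) / (2 * (s + 1))"
    have c: "c > C" unfolding c_def using B s by simp
    have "poincare_constant \<mu> = ennreal C" unfolding C_def using assms(6) by simp
    then have P: "poincare_constant \<mu> < ennreal c" using c C by (simp add: ennreal_lessI)
    have "(B - C * s) * s / (2 * (s + 1)) < B - C * s"
    proof (rule pos_divide_less_eq[THEN iffD2])
      show "(B - C * s) * s < (B - C * s) * (2 * (s + 1))"
        using B s by (intro mult_strict_left_mono) auto
    qed (use s in simp)
    moreover have "c * s = C * s + (B - C * s) * s / (2 * (s + 1))"
      unfolding c_def by (simp add: distrib_right)
    ultimately have "c * s < B" by linarith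
    then show "transport_cost 2 (\<mu> \<star> std_gaussian) std_gaussian \<le> ennreal B"
      "transport_cost 1 (\<mu> \<star> std_gaussian) std_gaussian \<le> ennreal (sqrt B)"
      using transport_cost_bounds[OF P _ cent'] c C unfolding s_def by auto
  qed
  have "transport_cost 2 (\<mu> \<star> std_gaussian) std_gaussian \<le> ennreal (C * s)"
    using bounds(1) by (rule ennreal_le_of_continuous) auto
  then have 1: "wasserstein 2 (\<mu> \<star> std_gaussian) std_gaussian \<le> ennreal (sqrt (C * s))"
    using wasserstein_le[of 2 _ _ "C * s"] s C by (simp add: powr_half_sqrt)
  have "transport_cost 1 (\<mu> \<star> std_gaussian) std_gaussian \<le> ennreal (sqrt (C * s))"
    using bounds(2) by (rule ennreal_le_of_continuous) (auto intro: isCont_real_sqrt)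
  then have 2: "wasserstein 1 (\<mu> \<star> std_gaussian) std_gaussian \<le> ennreal (sqrt (C * s))"
    using wasserstein_le[of 1 _ _ "sqrt (C * s)"] s C by simp
  show ?thesis using 1 2 unfolding tr C_def by blast
qed

end
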